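(* Let $h=\prod_{i=1}^{t}p_i^{s_i}$ with distinct primes $p_i$, $s_i\ge1$, and let $1\leq r\leq m\leq n$. The independence number, clique number and chromatic number of $\mathrm{Bil}_r(\mathbb{Z}_h^{m\times n})$ are $$\alpha=h^{n(m-r)},\qquad\omega=h^{nr},\qquad\chi=h^{nr}.$$
   Context: $\mathbb{Z}_h$ is the residue class ring modulo $h$. The inner rank $\rho(A)$ of a nonzero $A\in\mathbb{Z}_h^{m\times n}$ is the least $r$ with $A=BC$, $B\in\mathbb{Z}_h^{m\times r}$, $C\in\mathbb{Z}_h^{r\times n}$; $\rho(0)=0$. $\mathrm{Bil}_r(\mathbb{Z}_h^{m\times n})$ is the graph with vertex set $\mathbb{Z}_h^{m\times n}$ in which distinct $A,B$ are adjacent iff $\rho(A-B)\leq r$. *)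

theory Defs
  imports Main
begin

text \<open>Matrices over Z_h of size m x n: functions nat => nat => int with entries
  in {0..<h} (canonical residues) on the index range {0..<m} x {0..<n} and 0 outside.\<close>

definition zmat :: "nat \<Rightarrow> nat \<Rightarrow> nat \<Rightarrow> (nat \<Rightarrow> nat \<Rightarrow> int) set" where
  "zmat h m n = {A. \<forall>i j. (i < m \<and> j < n \<longrightarrow> 0 \<le> A i j \<and> A i j < int h)
                         \<and> (\<not> (i < m \<and> j < n) \<longrightarrow> A i j = 0)}"

definition zmat_diff :: "nat \<Rightarrow> (nat \<Rightarrow> nat \<Rightarrow> int) \<Rightarrow> (nat \<Rightarrow> nat \<Rightarrow> int) \<Rightarrow> (nat \<Rightarrow> nat \<Rightarrow> int)" where
  "zmat_diff h A B = (\<lambda>i j. (A i j - B i j) mod int h)"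

definition zfactors :: "nat \<Rightarrow> nat \<Rightarrow> nat \<Rightarrow> (nat \<Rightarrow> nat \<Rightarrow> int) \<Rightarrow> nat \<Rightarrow> bool" where
  "zfactors h m n A r = (\<exists>B \<in> zmat h m r. \<exists>C \<in> zmat h r n.
      \<forall>i<m. \<forall>j<n. A i j = (\<Sum>l<r. B i l * C l j) mod int h)"

text \<open>Inner rank: least r admitting such a factorization (for A = 0 this is 0).\<close>
definition inner_rank :: "nat \<Rightarrow> nat \<Rightarrow> nat \<Rightarrow> (nat \<Rightarrow> nat \<Rightarrow> int) \<Rightarrow> nat" where
  "inner_rank h m n A = (LEAST r. zfactors h m n A r)"

definition bil_adj :: "nat \<Rightarrow> nat \<Rightarrow> nat \<Rightarrow> nat \<Rightarrow> (nat \<Rightarrow> nat \<Rightarrow> int) \<Rightarrow> (nat \<Rightarrow> nat \<Rightarrow> int) \<Rightarrow> bool" where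
  "bil_adj h m n r A B = (A \<noteq> B \<and> inner_rank h m n (zmat_diff h A B) \<le> r)"

definition independence_number :: "'a set \<Rightarrow> ('a \<Rightarrow> 'a \<Rightarrow> bool) \<Rightarrow> nat" where
  "independence_number V E = Max {card S | S. S \<subseteq> V \<and> (\<forall>x\<in>S. \<forall>y\<in>S. x \<noteq> y \<longrightarrow> \<not> E x y)}"

definition clique_number :: "'a set \<Rightarrow> ('a \<Rightarrow> 'a \<Rightarrow> bool) \<Rightarrow> nat" where
  "clique_number V E = Max {card S | S. S \<subseteq> V \<and> (\<forall>x\<in>S. \<forall>y\<in>S. x \<noteq> y \<longrightarrow> E x y)}"

definition chromatic_number :: "'a set \<Rightarrow> ('a \<Rightarrow> 'a \<Rightarrow> bool) \<Rightarrow> nat" where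
  "chromatic_number V E = (LEAST k. \<exists>c :: 'a \<Rightarrow> nat. c ` V \<subseteq> {..<k} \<and>
       (\<forall>x\<in>V. \<forall>y\<in>V. E x y \<longrightarrow> c x \<noteq> c y))"

end

theory Submission
  imports Defs "HOL-Library.FuncSet" "HOL-Number_Theory.Cong"
    "Jordan_Normal_Form.Char_Poly"
begin

text \<open>Two partitions of the vertex set determine all three parameters. Matrices that agree outside
  their first \<open>r\<close> rows form cliques of size \<open>h\<^sup>n\<^sup>r\<close>, and the fibres of a linear syndrome map with
  \<open>h\<^sup>n\<^sup>r\<close> values are independent sets. For \<open>h\<close> prime the syndrome map is the parity check
  \<open>A \<mapsto> (\<Sum>\<^sub>i w\<^sub>i\<^bsup>p^j\<^esup> a\<^sub>i)\<close>, \<open>j < r\<close>, of a Gabidulin code over the field of order \<open>p\<^sup>n\<close>,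
  where the rows of \<open>A\<close> are read as field elements \<open>a\<^sub>i\<close>. For composite \<open>h\<close> the integer
  coefficients of these maps are glued by the Chinese remainder theorem. A product \<open>B C\<close> of inner
  size \<open>r\<close> that is divisible by \<open>p\<close> is \<open>p\<close> times another such product, so the prime factors of
  \<open>h\<close> can be stripped off one at a time.\<close>

subsection \<open>Frobenius and Moore systems in a residue field\<close>

text \<open>\<open>M\<close> is a maximal ideal with residue characteristic \<open>p\<close>. The
  quotient field is never formed: everything is a congruence modulo \<open>M\<close>, so that
  integer coefficients stand directly for elements of the prime field.\<close>

locale residue_field =
  fixes M :: "'a :: comm_ring_1 set" and p :: nat
  assumes zero_mem: "0 \<in> M"
    and add_mem: "a \<in> M \<Longrightarrow> b \<in> M \<Longrightarrow> a + b \<in> M"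
    and mult_mem: "a \<in> M \<Longrightarrow> a * b \<in> M"
    and one_notin: "1 \<notin> M"
    and inverse_ex: "a \<notin> M \<Longrightarrow> \<exists>b. a * b - 1 \<in> M"
    and prime_p: "prime p"
    and p_mem: "of_nat p \<in> M"
begin

definition cg :: "'a \<Rightarrow> 'a \<Rightarrow> bool"  (infix \<open>\<approx>\<close> 50)
  where "a \<approx> b \<longleftrightarrow> a - b \<in> M"

section \<open>Congruence modulo the maximal ideal\<close>

lemma mult_mem': "b \<in> M \<Longrightarrow> a * b \<in> M"
  using mult_mem[of b a] by (simp add: mult.commute)

lemma uminus_mem: "a \<in> M \<Longrightarrow> - a \<in> M"
  using mult_mem[of a "-1"] by simp

lemma diff_mem: "a \<in> M \<Longrightarrow> b \<in> M \<Longrightarrow> a - b \<in> M"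
  using add_mem[of a "-b"] uminus_mem by simp

lemma sum_mem: "(\<And>x. x \<in> A \<Longrightarrow> f x \<in> M) \<Longrightarrow> sum f A \<in> M"
  by (induction A rule: infinite_finite_induct) (auto simp: zero_mem add_mem)

lemma cg_refl [simp]: "a \<approx> a"
  by (simp add: cg_def zero_mem)

lemma cg_sym: "a \<approx> b \<Longrightarrow> b \<approx> a"
  using uminus_mem[of "a - b"] by (simp add: cg_def)

lemma cg_trans [trans]: "a \<approx> b \<Longrightarrow> b \<approx> c \<Longrightarrow> a \<approx> c"
  using add_mem[of "a - b" "b - c"] by (simp add: cg_def)

lemma cg_mem: "a \<approx> b \<Longrightarrow> b \<in> M \<Longrightarrow> a \<in> M"
  using add_mem[of "a - b" b] by (simp add: cg_def)

lemma cg_0_iff: "a \<approx> 0 \<longleftrightarrow> a \<in> M"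
  by (simp add: cg_def)

lemma cg_add: "a \<approx> b \<Longrightarrow> c \<approx> d \<Longrightarrow> a + c \<approx> b + d"
  using add_mem[of "a - b" "c - d"] by (simp add: cg_def algebra_simps)

lemma cg_mult: "a \<approx> b \<Longrightarrow> c \<approx> d \<Longrightarrow> a * c \<approx> b * d"
  using add_mem[OF mult_mem[of "a - b" c] mult_mem'[of "c - d" b]]
  by (simp add: cg_def algebra_simps)

lemma cg_power: "a \<approx> b \<Longrightarrow> a ^ k \<approx> b ^ k"
  by (induction k) (auto intro: cg_mult)

lemma cg_sum: "(\<And>x. x \<in> A \<Longrightarrow> f x \<approx> g x) \<Longrightarrow> sum f A \<approx> sum g A"
  by (induction A rule: infinite_finite_induct) (auto intro: cg_add)

text \<open>Inverses of \<open>a\<close> and \<open>b\<close> modulo \<open>M\<close> multiply to an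
  inverse of \<open>a * b\<close>, which an element of a proper ideal cannot have.\<close>

lemma prime_mem: assumes "a * b \<in> M" shows "a \<in> M \<or> b \<in> M"
proof (rule ccontr)
  assume "\<not> (a \<in> M \<or> b \<in> M)"
  then obtain a' b' where a: "a * a' \<approx> 1" and b: "b * b' \<approx> 1"
    using inverse_ex unfolding cg_def by metis
  have "1 \<approx> (a * a') * (b * b')"
    using cg_sym[OF cg_mult[OF a b]] by simp
  also have "(a * a') * (b * b') = (a * b) * (a' * b')"
    by (simp add: algebra_simps)
  finally show False
    using one_notin mult_mem[OF assms] cg_mem by blast
qed

lemma power_mem: "a ^ k \<in> M \<Longrightarrow> a \<in> M"
  by (induction k) (auto simp: one_notin dest: prime_mem)

text \<open>For \<open>u\<close> prime to \<open>p\<close>, a Bezout relation between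
  \<open>p\<close> and \<open>u\<close> would put 1 into \<open>M\<close>. Hence the integers reduce
  to a copy of the prime field.\<close>

lemma of_int_mem_iff: "of_int u \<in> M \<longleftrightarrow> int p dvd u"
proof
  assume "int p dvd u"
  then obtain v where "u = int p * v" ..
  then show "of_int u \<in> M"
    using mult_mem[OF p_mem, of "of_int v"] by simp
next
  assume u: "of_int u \<in> M"
  show "int p dvd u"
  proof (rule ccontr)
    assume "\<not> int p dvd u"
    then have "coprime (int p) u"
      using prime_p by (intro prime_imp_coprime) auto
    then obtain x y where "x * int p + y * u = 1"
      using bezout_int[of "int p" u] by auto
    then have "(1::'a) = of_int (x * int p + y * u)" by simp
    also have "\<dots> = of_int x * of_nat p + of_int y * of_int u" by simp
    also have "\<dots> \<in> M"
      using add_mem mult_mem' p_mem u by blast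
    finally show False using one_notin by simp
  qed
qed

lemma of_int_cg_iff: "of_int u \<approx> of_int v \<longleftrightarrow> int p dvd (u - v)"
  by (metis cg_def of_int_diff of_int_mem_iff)

section \<open>Frobenius and its fixed points\<close>

lemma frobenius_add: "(x + y) ^ p \<approx> x ^ p + y ^ p"
proof -
  have p: "p \<noteq> 0" using prime_p by auto
  let ?t = "\<lambda>k. of_nat (p choose k) * x ^ k * y ^ (p - k)"
  have "(x + y) ^ p = (\<Sum>k\<le>p. ?t k)"
    by (simp add: binomial_ring)
  also have "\<dots> = ?t 0 + ?t p + (\<Sum>k\<in>{..p} - {0, p}. ?t k)"
    using p by (subst sum.subset_diff[of "{0, p}"]) (auto simp: add_ac)
  also have "\<dots> - (x ^ p + y ^ p) = (\<Sum>k\<in>{..p} - {0, p}. ?t k)"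
    using p by simp
  also have "\<dots> \<in> M"
  proof (rule sum_mem)
    fix k assume "k \<in> {..p} - {0, p}"
    then have "p dvd (p choose k)"
      using prime_p by (intro dvd_choose_prime) auto
    then obtain c where "p choose k = p * c" ..
    then have "?t k = of_nat p * (of_nat c * x ^ k * y ^ (p - k))"
      by (simp add: algebra_simps)
    then show "?t k \<in> M"
      using mult_mem[OF p_mem] by simp
  qed
  finally show ?thesis by (simp add: cg_def)
qed

text \<open>Fermat's little theorem: additivity of Frobenius drives an induction over the naturals,
  and an arbitrary integer is replaced by its nonnegative residue modulo \<open>p\<close>.\<close>

lemma frobenius_of_int: "of_int u ^ p \<approx> of_int u"
proof -
  have p: "p > 0" using prime_p prime_gt_0_nat by auto
  have nat: "of_nat k ^ p \<approx> of_nat k" for k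
  proof (induction k)
    case (Suc k)
    have "(1 + of_nat k) ^ p \<approx> 1 ^ p + of_nat k ^ p"
      by (rule frobenius_add)
    also have "\<dots> \<approx> 1 + of_nat k"
      using Suc by (intro cg_add) auto
    finally show ?case by simp
  qed (use p in \<open>simp add: zero_power\<close>)
  define k where "k = nat (u mod int p)"
  have "int k = u mod int p"
    using p by (simp add: k_def)
  then have "int p dvd u - int k"
    by (simp add: minus_mod_eq_mult_div)
  then have k: "of_int u \<approx> of_nat k"
    using of_int_cg_iff[of u "int k"] by simp
  have "of_int u ^ p \<approx> of_nat k ^ p"
    by (rule cg_power[OF k])
  also have "\<dots> \<approx> of_nat k" by (rule nat)
  also have "\<dots> \<approx> of_int u" using k by (rule cg_sym)
  finally show ?thesis .
qed

lemma frobenius_sum: "(\<Sum>x\<in>A. f x) ^ p \<approx> (\<Sum>x\<in>A. f x ^ p)"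
proof (induction A rule: infinite_finite_induct)
  case (insert a A)
  have "(f a + sum f A) ^ p \<approx> f a ^ p + sum f A ^ p"
    by (rule frobenius_add)
  also have "\<dots> \<approx> f a ^ p + (\<Sum>x\<in>A. f x ^ p)"
    using insert by (intro cg_add) auto
  finally show ?case using insert by simp
qed (use prime_p in \<open>auto simp: zero_power prime_gt_0_nat\<close>)

lemma frobenius_sum_of_int:
  "(\<Sum>x\<in>A. of_int (u x) * f x) ^ (p ^ j) \<approx> (\<Sum>x\<in>A. of_int (u x) * f x ^ (p ^ j))"
proof (induction j)
  case (Suc j)
  have "(\<Sum>x\<in>A. of_int (u x) * f x) ^ (p ^ Suc j) = ((\<Sum>x\<in>A. of_int (u x) * f x) ^ (p ^ j)) ^ p"
    by (simp add: power_mult[symmetric] mult.commute)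
  also have "\<dots> \<approx> (\<Sum>x\<in>A. of_int (u x) * f x ^ (p ^ j)) ^ p"
    by (rule cg_power[OF Suc])
  also have "\<dots> \<approx> (\<Sum>x\<in>A. (of_int (u x) * f x ^ (p ^ j)) ^ p)"
    by (rule frobenius_sum)
  also have "\<dots> \<approx> (\<Sum>x\<in>A. of_int (u x) * (f x ^ (p ^ j)) ^ p)"
    by (intro cg_sum) (auto simp: power_mult_distrib intro!: cg_mult frobenius_of_int)
  finally show ?case
    by (simp add: power_mult[symmetric] mult.commute)
qed simp

text \<open>The usual bound on roots over a field, by splitting off linear factors; pairwise
  incongruent elements of \<open>S\<close> stand for distinct roots in the quotient. Requiring
  \<open>P\<close> monic keeps its degree from dropping modulo \<open>M\<close>.\<close>

lemma card_roots_le_degree: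
  assumes "finite S" "lead_coeff P = 1" "\<And>x. x \<in> S \<Longrightarrow> poly P x \<in> M"
    and "\<And>x y. x \<in> S \<Longrightarrow> y \<in> S \<Longrightarrow> x \<approx> y \<Longrightarrow> x = y"
  shows "card S \<le> degree P"
  using assms
proof (induction "degree P" arbitrary: P S)
  case 0
  then have "P = 1"
    by (metis degree_eq_zeroE lead_coeff_pCons(2) one_pCons pCons_0_0 leading_coeff_0_iff)
  with 0 one_notin have "S = {}" by auto
  then show ?case by simp
next
  case (Suc n)
  show ?case
  proof (cases "S = {}")
    case False
    then obtain c where c: "c \<in> S" by blast
    let ?Q = "synthetic_div P c"
    have deg: "degree ?Q = n"
      using Suc(2) by (simp add: degree_synthetic_div)
    \<comment> \<open>Comparing top coefficients in the division identity shows that the quotient is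
      again monic, as the induction demands.\<close>
    have "coeff (P + Polynomial.smult c ?Q) (Suc n) = coeff (pCons (poly P c) ?Q) (Suc n)"
      by (simp add: synthetic_div_correct)
    then have lead: "lead_coeff ?Q = 1"
      using Suc(4) deg unfolding Suc(2)[symmetric] by (simp add: coeff_eq_0)
    have "poly ?Q x \<in> M" if x: "x \<in> S - {c}" for x
    proof -
      have "poly P x = poly ([:- c, 1:] * ?Q + [:poly P c:]) x"
        by (simp only: synthetic_div_correct')
      then have "(x - c) * poly ?Q x = poly P x - poly P c"
        by (simp add: algebra_simps)
      then have "(x - c) * poly ?Q x \<in> M"
        using Suc(5) x c by (auto intro: diff_mem)
      moreover have "x - c \<notin> M"
        using Suc(6)[of x c] x c by (auto simp: cg_def)
      ultimately show ?thesis using prime_mem by blast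
    qed
    then have "card (S - {c}) \<le> n"
      using Suc(1)[of ?Q "S - {c}"] deg lead Suc(3,6) by auto
    then show ?thesis
      using Suc(2,3) c by (simp add: card_Diff_singleton)
  qed simp
qed

text \<open>The elements of \<open>S\<close> are roots of the monic polynomial
  \<open>X^k - X\<close>. With \<open>k = p\<close> this singles out the prime field, with
  \<open>k = p^n\<close> it bounds the whole residue field.\<close>

lemma card_fixed_points_le:
  assumes "k \<ge> 2" "finite S" "\<And>x. x \<in> S \<Longrightarrow> x ^ k \<approx> x"
    and "\<And>x y. x \<in> S \<Longrightarrow> y \<in> S \<Longrightarrow> x \<approx> y \<Longrightarrow> x = y"
  shows "card S \<le> k"
proof -
  let ?P = "monom 1 k + [:0, - 1:] :: 'a poly"
  have deg: "degree ?P = k"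
    using assms(1) by (subst degree_add_eq_left) (auto simp: degree_monom_eq)
  have "lead_coeff ?P = 1"
    unfolding deg using assms(1) by (simp add: coeff_eq_0)
  moreover have "poly ?P x \<in> M" if "x \<in> S" for x
    using assms(3)[OF that] by (simp add: cg_def poly_monom)
  ultimately show ?thesis
    using card_roots_le_degree[of S ?P] assms deg by auto
qed

text \<open>The integers from 0 to \<open>p - 1\<close> already supply \<open>p\<close> incongruent
  fixed points, so a further one would exceed the root bound.\<close>

lemma frobenius_fixed_point:
  assumes "x ^ p \<approx> x"
  obtains u :: int where "x \<approx> of_int u"
proof (rule ccontr)
  assume "\<not> thesis"
  with that have x: "\<not> x \<approx> of_int u" for u by blast
  define Z :: "'a set" where "Z = of_int ` {0..<int p}"
  have eq: "u = v" if "u \<in> {0..<int p}" "v \<in> {0..<int p}" "of_int u \<approx> of_int v" for u v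
    using that by (metis atLeastLessThan_iff mod_eq_dvd_iff mod_pos_pos_trivial of_int_cg_iff)
  have inj: "inj_on (of_int :: int \<Rightarrow> 'a) {0..<int p}"
    using eq by (intro inj_onI) auto
  have "card Z = p"
    unfolding Z_def by (subst card_image[OF inj]) auto
  moreover have "x \<notin> Z"
    using x cg_refl unfolding Z_def by blast
  moreover have "finite Z" by (simp add: Z_def)
  moreover have "card (insert x Z) \<le> p"
  proof (rule card_fixed_points_le)
    show "p \<ge> 2" using prime_p prime_ge_2_nat by auto
    show "y ^ p \<approx> y" if "y \<in> insert x Z" for y
      using that assms frobenius_of_int by (auto simp: Z_def)
    show "y = z" if "y \<in> insert x Z" "z \<in> insert x Z" "y \<approx> z" for y z
      using that x cg_sym eq by (fastforce simp: Z_def)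
  qed (simp add: Z_def)
  ultimately show False by simp
qed

section \<open>Linear independence over the prime field\<close>

definition independent :: "'b set \<Rightarrow> ('b \<Rightarrow> 'a) \<Rightarrow> bool" where
  "independent L f \<longleftrightarrow>
     (\<forall>u :: 'b \<Rightarrow> int. (\<Sum>l\<in>L. of_int (u l) * f l) \<in> M \<longrightarrow> (\<forall>l\<in>L. int p dvd u l))"

lemma independentD:
  "independent L f \<Longrightarrow> (\<Sum>l\<in>L. of_int (u l) * f l) \<in> M \<Longrightarrow> l \<in> L \<Longrightarrow> int p dvd u l"
  by (auto simp: independent_def)

lemma independent_subset:
  assumes "independent L f" "K \<subseteq> L" "finite L"
  shows "independent K f"
  unfolding independent_def
proof (intro allI impI ballI)
  fix u :: "'b \<Rightarrow> int" and l
  assume l: "l \<in> K"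
  assume "(\<Sum>l\<in>K. of_int (u l) * f l) \<in> M"
  also have "(\<Sum>l\<in>K. of_int (u l) * f l) = (\<Sum>l\<in>L. of_int (if l \<in> K then u l else 0) * f l)"
    using assms(2,3) by (intro sum.mono_neutral_cong_left) auto
  finally show "int p dvd u l"
    using independentD[OF assms(1)] l assms(2) by fastforce
qed

text \<open>Frobenius is linear over the prime field and injective modulo \<open>M\<close>, so a
  relation among the \<open>p\<close>-th powers comes from one among the elements
  themselves.\<close>

lemma independent_frobenius:
  assumes "independent L f"
  shows "independent L (\<lambda>l. f l ^ p)"
  unfolding independent_def
proof (intro allI impI)
  fix u :: "'b \<Rightarrow> int"
  assume u: "(\<Sum>l\<in>L. of_int (u l) * f l ^ p) \<in> M"
  have "(\<Sum>l\<in>L. of_int (u l) * f l) ^ p \<in> M"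
    using cg_mem[OF frobenius_sum_of_int[of u f L 1]] u by simp
  then have "(\<Sum>l\<in>L. of_int (u l) * f l) \<in> M"
    by (rule power_mem)
  then show "\<forall>l\<in>L. int p dvd u l"
    using assms by (auto simp: independent_def)
qed

text \<open>If some \<open>c l\<^sub>0\<close> were nonzero, normalise it to 1; subtracting each equation from the
  Frobenius image of its predecessor eliminates \<open>l\<^sub>0\<close>, so that all \<open>c l\<close> are fixed by Frobenius,
  that is, lie in the prime field. This contradicts the independence of \<open>f\<close>.\<close>

lemma moore_system_trivial:
  assumes "finite L" "independent L f"
    and "\<And>j. j < card L \<Longrightarrow> (\<Sum>l\<in>L. c l * f l ^ (p ^ j)) \<in> M"
    and "l \<in> L"
  shows "c l \<in> M"
  using assms
proof (induction "card L" arbitrary: L f c l)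
  case (Suc n)
  note fin = Suc(3) and ind = Suc(4) and eqs = Suc(5)
  show ?case
  proof (rule ccontr)
    assume "c l \<notin> M"
    then obtain d where d: "c l * d \<approx> 1"
      using inverse_ex by (auto simp: cg_def)
    define e where "e = (\<lambda>k. c k * d)"
    have e: "(\<Sum>k\<in>L. e k * f k ^ (p ^ j)) \<in> M" if "j < card L" for j
      using mult_mem[OF eqs[OF that], of d] by (simp add: e_def sum_distrib_left mult_ac)
    let ?L = "L - {l}"
    have "e l ^ p \<approx> 1 ^ p"
      using d cg_power unfolding e_def by blast
    also have "1 ^ p \<approx> e l" using d cg_sym by (simp add: e_def)
    finally have l: "e l ^ p - e l \<in> M" by (simp add: cg_def)
    have fixed: "e k ^ p - e k \<in> M" if k: "k \<in> L" for k
    proof (cases "k = l")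
      case True
      then show ?thesis using l by simp
    next
      case False
      show ?thesis
      proof (rule Suc(1)[of ?L "\<lambda>k. f k ^ p"])
        show "n = card ?L" using Suc(2) \<open>l \<in> L\<close> fin by simp
        show "independent ?L (\<lambda>k. f k ^ p)"
          by (rule independent_frobenius, rule independent_subset[OF ind _ fin]) auto
        fix j assume "j < card ?L"
        then have j: "j < card L" "Suc j < card L"
          using \<open>l \<in> L\<close> fin by auto
        have "(\<Sum>k\<in>L. e k * f k ^ (p ^ j)) ^ p \<in> M"
          using e[OF j(1)] mult_mem prime_p by (cases p) auto
        then have "(\<Sum>k\<in>L. (e k * f k ^ (p ^ j)) ^ p) \<in> M"
          using cg_mem[OF cg_sym[OF frobenius_sum]] by blast
        then have "(\<Sum>k\<in>L. (e k * f k ^ (p ^ j)) ^ p) - (\<Sum>k\<in>L. e k * f k ^ (p ^ Suc j)) \<in> M"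
          using e[OF j(2)] by (rule diff_mem)
        also have "(\<Sum>k\<in>L. (e k * f k ^ (p ^ j)) ^ p) - (\<Sum>k\<in>L. e k * f k ^ (p ^ Suc j))
            = (\<Sum>k\<in>L. (e k ^ p - e k) * (f k ^ p) ^ (p ^ j))"
          by (simp add: sum_subtractf[symmetric] algebra_simps power_mult_distrib
              power_mult[symmetric])
        also have "\<dots> = (e l ^ p - e l) * (f l ^ p) ^ (p ^ j) +
            (\<Sum>k\<in>?L. (e k ^ p - e k) * (f k ^ p) ^ (p ^ j))"
          using fin \<open>l \<in> L\<close> by (simp add: sum.remove)
        finally have *: "(e l ^ p - e l) * (f l ^ p) ^ (p ^ j) +
            (\<Sum>k\<in>?L. (e k ^ p - e k) * (f k ^ p) ^ (p ^ j)) \<in> M" .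
        from diff_mem[OF * mult_mem[OF l, of "(f l ^ p) ^ (p ^ j)"]]
        show "(\<Sum>k\<in>?L. (e k ^ p - e k) * (f k ^ p) ^ (p ^ j)) \<in> M" by simp
      qed (use k False fin in auto)
    qed
    have "\<exists>u :: int. e k \<approx> of_int u" if "k \<in> L" for k
      using frobenius_fixed_point fixed[OF that] unfolding cg_def by metis
    then obtain u :: "'b \<Rightarrow> int" where u: "\<And>k. k \<in> L \<Longrightarrow> e k \<approx> of_int (u k)"
      by metis
    have "(\<Sum>k\<in>L. of_int (u k) * f k) \<approx> (\<Sum>k\<in>L. e k * f k ^ (p ^ 0))"
      using u cg_sym by (intro cg_sum) (auto intro!: cg_mult)
    then have "(\<Sum>k\<in>L. of_int (u k) * f k) \<in> M"
      using e[of 0] cg_mem Suc(2) by (metis zero_less_Suc)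
    then have "int p dvd u l"
      using independentD[OF ind _ \<open>l \<in> L\<close>] by blast
    then have "of_int (u l) \<in> M" by (simp add: of_int_mem_iff)
    then have "e l \<in> M" using u[OF \<open>l \<in> L\<close>] cg_mem by blast
    then have "1 \<in> M" using cg_mem[OF cg_sym[OF d]] by (simp add: e_def)
    then show False using one_notin by simp
  qed
qed simp

end

subsection \<open>Residue fields of prime power order\<close>

text \<open>Coefficients matter only modulo \<open>p\<close>, so the span of \<open>d\<close>
  elements meets at most \<open>p^d\<close> classes. Some \<open>t\<close> in the larger incongruent
  set \<open>S\<close> therefore lies outside the span and can be adjoined.\<close>

lemma (in residue_field) independent_extend:
  assumes ind: "independent {..<d} w" and S: "card S > p ^ d"
    and inc: "\<And>x y. x \<in> S \<Longrightarrow> y \<in> S \<Longrightarrow> x \<approx> y \<Longrightarrow> x = y"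
  shows "\<exists>t. independent {..<Suc d} (w(d := t))"
proof -
  define C where "C = {..<d} \<rightarrow>\<^sub>E {0..<int p}"
  define g where "g = (\<lambda>u :: nat \<Rightarrow> int. \<Sum>i<d. of_int (u i) * w i)"
  have C: "finite C" "card C = p ^ d"
    by (auto simp: C_def card_PiE intro: finite_PiE)
  have reduce: "\<exists>u'\<in>C. g u \<approx> g u'" for u
  proof
    let ?u = "\<lambda>i\<in>{..<d}. u i mod int p"
    show "?u \<in> C"
      using prime_p by (auto simp: C_def prime_gt_0_nat)
    show "g u \<approx> g ?u"
      unfolding g_def by (intro cg_sum cg_mult) (auto simp: of_int_cg_iff minus_mod_eq_mult_div)
  qed
  have "\<exists>t\<in>S. \<forall>u. \<not> t \<approx> g u"
  proof (rule ccontr)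
    assume "\<not> ?thesis"
    then have "\<exists>u\<in>C. t \<approx> g u" if "t \<in> S" for t
      using reduce cg_trans that by meson
    then obtain f where f: "\<And>t. t \<in> S \<Longrightarrow> f t \<in> C \<and> t \<approx> g (f t)"
      by metis
    have "inj_on f S"
      using f inc cg_sym cg_trans by (intro inj_onI) metis
    then have "card S \<le> card C"
      using f C(1) by (intro card_inj_on_le) auto
    then show False using S C(2) by simp
  qed
  then obtain t where t: "\<And>u. \<not> t \<approx> g u" by blast
  have "independent {..<Suc d} (w(d := t))"
    unfolding independent_def
  proof (rule allI, rule impI)
    fix u :: "nat \<Rightarrow> int"
    assume "(\<Sum>l<Suc d. of_int (u l) * (w(d := t)) l) \<in> M"
    then have u: "g u + of_int (u d) * t \<in> M"
      by (simp add: g_def)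
    \<comment> \<open>Otherwise \<open>u d\<close> has an inverse \<open>y\<close> modulo
      \<open>p\<close>, and solving the relation for \<open>t\<close> would put \<open>t\<close>
      into the span.\<close>
    have ud: "int p dvd u d"
    proof (rule ccontr)
      assume "\<not> int p dvd u d"
      then have "coprime (int p) (u d)"
        using prime_p by (intro prime_imp_coprime) auto
      then obtain x y where xy: "x * int p + y * u d = 1"
        using bezout_int[of "int p" "u d"] by auto
      have "t - of_int (y * u d) * t = t * of_nat p * of_int x"
        using arg_cong[OF xy, of "\<lambda>z. of_int z * t"] by (simp add: algebra_simps)
      also have "\<dots> \<in> M"
        using mult_mem mult_mem' p_mem by blast
      finally have "t \<approx> of_int (y * u d) * t" by (simp add: cg_def)
      also have "of_int (y * u d) * t \<approx> g (\<lambda>i. - y * u i)"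
        using mult_mem'[OF u, of "of_int y"]
        by (simp add: cg_def g_def sum_distrib_left sum_negf algebra_simps)
      finally show False using t by blast
    qed
    then have "of_int (u d) * t \<in> M"
      using mult_mem of_int_mem_iff by blast
    from diff_mem[OF u this] have "g u \<in> M" by simp
    then show "\<forall>l\<in>{..<Suc d}. int p dvd u l"
      using ud independentD[OF ind, of u] by (auto simp: g_def less_Suc_eq)
  qed
  then show ?thesis ..
qed

text \<open>Extension yields \<open>n\<close> independent elements. Their combinations give
  \<open>p^n\<close> distinct classes, as many as \<open>S\<close> represents, so by counting they
  span everything.\<close>

lemma (in residue_field) basis_exists:
  assumes S: "finite S" "card S = p ^ n"
    and inc: "\<And>x y. x \<in> S \<Longrightarrow> y \<in> S \<Longrightarrow> x \<approx> y \<Longrightarrow> x = y"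
    and cov: "\<And>x. \<exists>t\<in>S. x \<approx> t"
  shows "\<exists>w. independent {..<n} w \<and> (\<forall>x. \<exists>u. x \<approx> (\<Sum>i<n. of_int (u i) * w i))"
proof -
  have "\<exists>w. independent {..<d} w" if "d \<le> n" for d
    using that
  proof (induction d)
    case 0
    show ?case by (simp add: independent_def)
  next
    case (Suc d)
    then obtain w where "independent {..<d} w" by auto
    moreover have "card S > p ^ d"
      using Suc(2) S prime_gt_1_nat[OF prime_p] by (simp add: power_strict_increasing)
    ultimately show ?case
      using independent_extend inc by metis
  qed
  then obtain w where w: "independent {..<n} w" by blast
  define C where "C = {..<n} \<rightarrow>\<^sub>E {0..<int p}"
  define g where "g = (\<lambda>u :: nat \<Rightarrow> int. \<Sum>i<n. of_int (u i) * w i)"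
  obtain f where f: "\<And>x. f x \<in> S \<and> x \<approx> f x"
    using cov by metis
  have "inj_on (f \<circ> g) C"
  proof (rule inj_onI)
    fix u v assume u: "u \<in> C" and v: "v \<in> C" and "(f \<circ> g) u = (f \<circ> g) v"
    then have "g u \<approx> g v"
      using f cg_sym cg_trans by (metis comp_apply)
    then have *: "(\<Sum>i<n. of_int (u i - v i) * w i) \<in> M"
      by (simp add: cg_def g_def sum_subtractf[symmetric] algebra_simps)
    have "int p dvd u i - v i" if "i < n" for i
      using independentD[OF w *] that by simp
    then have "u i = v i" if "i < n" for i
      using u v that unfolding C_def
      by (metis PiE_mem atLeastLessThan_iff lessThan_iff mod_eq_dvd_iff mod_pos_pos_trivial)
    then show "u = v"
      using u v unfolding C_def by (intro PiE_ext) auto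
  qed
  moreover have "card C = p ^ n"
    by (auto simp: C_def card_PiE)
  ultimately have "card ((f \<circ> g) ` C) = card S"
    using S by (metis card_image)
  then have surj: "(f \<circ> g) ` C = S"
    using f S(1) by (intro card_subset_eq) auto
  have "\<exists>u. x \<approx> g u" for x
  proof -
    obtain u where "f x = f (g u)"
      using f[of x] surj by (metis comp_apply imageE)
    then have "x \<approx> g u" using f cg_sym cg_trans by metis
    then show ?thesis by blast
  qed
  then show ?thesis
    using w by (auto simp: g_def)
qed

text \<open>The value \<open>poly Q z\<close> is an eigenvalue of the integer circulant matrix formed from the
  coefficients of \<open>Q\<close>, with eigenvector \<open>(1, z, \<dots>, z\<^sup>N\<^sup>-\<^sup>1)\<close>.\<close>

lemma algebraic_int_poly_root_of_unity:
  fixes z :: "'a :: field_char_0"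
  assumes z: "z ^ N = 1" and N: "N > 0"
  shows "algebraic_int (poly (of_int_poly Q) z)"
proof -
  define A :: "int mat" where
    "A = mat N N (\<lambda>(i, j). \<Sum>k\<le>degree Q. if (i + k) mod N = j then coeff Q k else 0)"
  define v where "v = vec N (\<lambda>j. z ^ j)"
  define ev where "ev = poly (of_int_poly Q) z"
  let ?A = "map_mat of_int A :: 'a mat"
  have A: "A \<in> carrier_mat N N" by (simp add: A_def)
  have power_mod: "z ^ (k mod N) = z ^ k" for k
  proof -
    have "z ^ k = z ^ (N * (k div N) + k mod N)" by simp
    also have "\<dots> = z ^ (k mod N)"
      by (subst power_add) (simp add: power_mult z)
    finally show ?thesis by simp
  qed
  have "?A *\<^sub>v v = ev \<cdot>\<^sub>v v"
  proof (rule eq_vecI)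
    fix i assume "i < dim_vec (ev \<cdot>\<^sub>v v)"
    then have i: "i < N" by (simp add: v_def)
    then have "(?A *\<^sub>v v) $ i = (\<Sum>j<N. of_int (A $$ (i, j)) * z ^ j)"
      using A by (simp add: v_def scalar_prod_def lessThan_atLeast0)
    also have "\<dots> = (\<Sum>j<N. \<Sum>k\<le>degree Q.
        if (i + k) mod N = j then of_int (coeff Q k) * z ^ j else 0)"
      using i by (intro sum.cong)
        (auto simp: A_def sum_distrib_right of_int_sum if_distrib cong: if_cong intro!: sum.cong)
    also have "\<dots> = (\<Sum>k\<le>degree Q. \<Sum>j<N.
        if (i + k) mod N = j then of_int (coeff Q k) * z ^ j else 0)"
      by (rule sum.swap)
    also have "\<dots> = (\<Sum>k\<le>degree Q. of_int (coeff Q k) * z ^ ((i + k) mod N))"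
      using N by (intro sum.cong) (auto simp: sum.delta)
    also have "\<dots> = z ^ i * ev"
      by (simp add: power_mod power_add ev_def poly_altdef sum_distrib_left mult_ac)
    finally show "(?A *\<^sub>v v) $ i = (ev \<cdot>\<^sub>v v) $ i"
      using i by (simp add: v_def mult.commute)
  qed (use A in \<open>auto simp: v_def\<close>)
  moreover have "v \<noteq> 0\<^sub>v N"
  proof
    assume "v = 0\<^sub>v N"
    then have "v $ 0 = 0" using N by simp
    then show False using N by (simp add: v_def)
  qed
  ultimately have "eigenvalue ?A ev"
    using A unfolding eigenvalue_def eigenvector_def
    by (intro exI[of _ v]) (auto simp: v_def)
  then have "poly (char_poly ?A) ev = 0"
    using eigenvalue_root_char_poly[of ?A N] A by auto
  then have "poly (of_int_poly (char_poly A)) ev = 0"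
    using of_int_hom.char_poly_hom[OF A] by metis
  moreover have "lead_coeff (char_poly A) = 1"
    using degree_monic_char_poly[OF A] by simp
  ultimately show ?thesis
    unfolding algebraic_int_altdef_ipoly ev_def by blast
qed

text \<open>Otherwise \<open>1 / p\<close> would be a rational algebraic integer, hence an integer.
  This makes \<open>p\<close> generate a proper ideal in the ring obtained by adjoining
  \<open>z\<close> to the integers.\<close>

lemma prime_not_unit_root_of_unity:
  fixes z :: complex
  assumes "z ^ N = 1" "N > 0" "prime p"
  shows "1 \<noteq> of_nat p * poly (of_int_poly Q) z"
proof
  assume *: "1 = of_nat p * poly (of_int_poly Q) z"
  have p: "of_nat p \<noteq> (0 :: complex)" using assms(3) by auto
  from * have "poly (of_int_poly Q) z = 1 / of_nat p"
    using p by (simp add: field_simps)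
  moreover from this have "poly (of_int_poly Q) z \<in> \<rat>" by simp
  ultimately have "1 / of_nat p \<in> (\<int> :: complex set)"
    using rational_algebraic_int_is_int[OF algebraic_int_poly_root_of_unity[OF assms(1,2)]]
    by metis
  then obtain k :: int where "1 / of_nat p = (of_int k :: complex)" by (auto elim: Ints_cases)
  then have "(of_int (int p * k) :: complex) = of_int 1"
    using p by (simp add: field_simps)
  then have "int p * k = 1" by (simp only: of_int_eq_iff)
  then have "int p dvd 1" by (metis dvd_triv_left)
  then show False using assms(3) by auto
qed

section \<open>A maximal ideal above \<open>p\<close>\<close>

lemma maximal_ideal_exists:
  fixes I :: "'a :: comm_ring_1 set"
  assumes I: "0 \<in> I" "\<And>a b. a \<in> I \<Longrightarrow> b \<in> I \<Longrightarrow> a + b \<in> I" "\<And>a b. a \<in> I \<Longrightarrow> a * b \<in> I"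
    and I1: "1 \<notin> I" and p: "of_nat p \<in> I" "prime p"
  shows "\<exists>M. I \<subseteq> M \<and> residue_field M p"
proof -
  define \<A> where "\<A> = {J. I \<subseteq> J \<and> (\<forall>a\<in>J. \<forall>b\<in>J. a + b \<in> J) \<and> (\<forall>a\<in>J. \<forall>b. a * b \<in> J) \<and> 1 \<notin> J}"
  have "\<exists>M\<in>\<A>. \<forall>X\<in>\<A>. M \<subseteq> X \<longrightarrow> X = M"
  proof (rule subset_Zorn_nonempty)
    have "I \<in> \<A>" unfolding \<A>_def using I I1 by blast
    then show "\<A> \<noteq> {}" by blast
    fix \<C> assume ne: "\<C> \<noteq> {}" and ch: "subset.chain \<A> \<C>"
    then have sub: "\<C> \<subseteq> \<A>" and tot: "\<And>X Y. X \<in> \<C> \<Longrightarrow> Y \<in> \<C> \<Longrightarrow> X \<subseteq> Y \<or> Y \<subseteq> X"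
      by (auto simp: subset_chain_def)
    have "a + b \<in> \<Union>\<C>" if ab: "a \<in> \<Union>\<C>" "b \<in> \<Union>\<C>" for a b
    proof -
      obtain X where "X \<in> \<C>" "a \<in> X" "b \<in> X"
        using ab tot by blast
      then show ?thesis using sub unfolding \<A>_def by blast
    qed
    moreover have "I \<subseteq> \<Union>\<C>" "1 \<notin> \<Union>\<C>" "\<forall>a\<in>\<Union>\<C>. \<forall>b. a * b \<in> \<Union>\<C>"
      using ne sub unfolding \<A>_def by blast+
    ultimately show "\<Union>\<C> \<in> \<A>" unfolding \<A>_def by blast
  qed
  then obtain M where M: "M \<in> \<A>" and max: "\<And>X. X \<in> \<A> \<Longrightarrow> M \<subseteq> X \<Longrightarrow> X = M"
    by blast
  have sub: "I \<subseteq> M" and add: "\<And>a b. a \<in> M \<Longrightarrow> b \<in> M \<Longrightarrow> a + b \<in> M"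
    and mult: "\<And>a b. a \<in> M \<Longrightarrow> a * b \<in> M" and one: "1 \<notin> M"
    using M unfolding \<A>_def by blast+
  have "residue_field M p"
  proof
    fix a assume a: "a \<notin> M"
    \<comment> \<open>The ideal generated by \<open>M\<close> and \<open>a\<close>. It is strictly
      larger than \<open>M\<close>, so by maximality it contains 1, and this yields the inverse of
      \<open>a\<close>.\<close>
    define X where "X = {m + a * b | m b. m \<in> M}"
    have "M \<subseteq> X"
    proof
      fix x assume "x \<in> M"
      then show "x \<in> X" unfolding X_def by (intro CollectI exI[of _ x] exI[of _ 0]) simp
    qed
    have "0 + a * 1 \<in> X" unfolding X_def using I(1) sub by blast
    then have "X \<noteq> M" using a by auto
    then have "X \<notin> \<A>" using max \<open>M \<subseteq> X\<close> by blast
    moreover have "x + y \<in> X" if "x \<in> X" "y \<in> X" for x y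
    proof -
      from that obtain m b m' b' where "m \<in> M" "m' \<in> M" "x = m + a * b" "y = m' + a * b'"
        unfolding X_def by blast
      then have "m + m' \<in> M" "x + y = (m + m') + a * (b + b')"
        using add by (auto simp: algebra_simps)
      then show ?thesis unfolding X_def by blast
    qed
    moreover have "x * c \<in> X" if "x \<in> X" for x c
    proof -
      from that obtain m b where "m \<in> M" "x = m + a * b"
        unfolding X_def by blast
      then have "m * c \<in> M" "x * c = m * c + a * (b * c)"
        using mult by (blast, simp add: algebra_simps)
      then show ?thesis unfolding X_def by blast
    qed
    ultimately have "1 \<in> X" using \<open>M \<subseteq> X\<close> sub unfolding \<A>_def by blast
    then obtain m b where "m \<in> M" "1 = m + a * b" unfolding X_def by blast
    then have "a * b - 1 = m * (- 1)" by (simp add: algebra_simps)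
    then show "\<exists>b. a * b - 1 \<in> M" using mult \<open>m \<in> M\<close> by metis
  qed (use sub I(1) p one in \<open>blast intro: add mult\<close>)+
  then show ?thesis using sub by blast
qed

text \<open>The residue field of order \<open>p\<^sup>n\<close> is realised as a quotient of the ring of integer
  polynomials by a maximal ideal above \<open>p\<close> that contains all polynomials vanishing at a primitive
  root of unity of order \<open>N = p\<^sup>n - 1\<close>. The residue of \<open>X\<close> has order exactly \<open>N\<close>: if
  \<open>X\<^sup>k \<equiv> 1\<close> with \<open>0 < k < N\<close>, then the vanishing sum of the powers of \<open>\<zeta>\<^sup>k\<close> would give
  \<open>N \<equiv> 0\<close>, while \<open>N \<equiv> -1\<close>.\<close>

theorem residue_field_exists:
  fixes p n :: nat
  assumes p: "prime p" and n: "n > 0"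
  shows "\<exists>(M :: int poly set) w. residue_field M p \<and> residue_field.independent M p {..<n} w \<and>
    (\<forall>x. \<exists>u. residue_field.cg M x (\<Sum>i<n. of_int (u i) * w i))"
proof -
  define q where "q = p ^ n"
  define N where "N = q - 1"
  have "q \<ge> 2"
  proof -
    have "p \<le> p ^ n"
      using p n by (intro self_le_power) (auto simp: prime_gt_0_nat Suc_leI)
    moreover have "p \<ge> 2" using p by (rule prime_ge_2_nat)
    ultimately show ?thesis by (simp add: q_def)
  qed
  then have N: "N > 0" and qN: "q = Suc N" by (auto simp: N_def)
  define \<zeta> where "\<zeta> = cis (2 * pi / real N)"
  have \<zeta>_pow: "\<zeta> ^ k = cis (2 * pi * real k / real N)" for k
    by (simp add: \<zeta>_def DeMoivre mult_ac)
  have \<zeta>N: "\<zeta> ^ N = 1" using N by (simp add: \<zeta>_pow)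
  have \<zeta>k: "\<zeta> ^ k \<noteq> 1" if "0 < k" "k < N" for k
  proof
    assume "\<zeta> ^ k = 1"
    then have "cis (2 * pi * real k / real N) = cis (2 * pi * real 0 / real N)"
      by (simp add: \<zeta>_pow)
    then have "k = 0"
      using bij_betw_roots_unity[OF N] that N unfolding bij_betw_def
      by (metis (no_types, lifting) inj_onD lessThan_iff)
    then show False using that by simp
  qed
  define ev where "ev = (\<lambda>P. poly (of_int_poly P) \<zeta>)"
  have ev: "ev (P + Q) = ev P + ev Q" "ev (P * Q) = ev P * ev Q" "ev 0 = 0" "ev 1 = 1"
    "ev (of_nat m) = of_nat m" "ev [:0, 1:] = \<zeta>" "ev (P ^ m) = ev P ^ m" "ev (P - Q) = ev P - ev Q"
    "ev (sum f A) = (\<Sum>a\<in>A. ev (f a))" for P Q m and f :: "nat \<Rightarrow> int poly" and A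
    by (simp_all add: ev_def hom_distribs poly_sum)
  \<comment> \<open>The preimage under evaluation at \<open>\<zeta>\<close> of the ideal generated
    by \<open>p\<close>; taking \<open>Q = 0\<close> shows that it contains every polynomial
    vanishing at \<open>\<zeta>\<close>.\<close>
  define I where "I = {P. \<exists>Q. ev P = of_nat p * ev Q}"
  have "\<exists>M. I \<subseteq> M \<and> residue_field M p"
  proof (rule maximal_ideal_exists)
    show "0 \<in> I" using ev(3) by (auto simp: I_def intro!: exI[of _ 0])
    show "a + b \<in> I" if "a \<in> I" "b \<in> I" for a b
    proof -
      from that obtain Q R where "ev a = of_nat p * ev Q" "ev b = of_nat p * ev R"
        by (auto simp: I_def)
      then have "ev (a + b) = of_nat p * ev (Q + R)" by (simp add: ev algebra_simps)
      then show ?thesis by (auto simp: I_def)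
    qed
    show "a * b \<in> I" if "a \<in> I" for a b
    proof -
      from that obtain Q where "ev a = of_nat p * ev Q" by (auto simp: I_def)
      then have "ev (a * b) = of_nat p * ev (Q * b)" by (simp add: ev algebra_simps)
      then show ?thesis by (auto simp: I_def)
    qed
    show "1 \<notin> I"
      using prime_not_unit_root_of_unity[OF \<zeta>N N p] by (auto simp: I_def ev(4)) (auto simp: ev_def)
    show "of_nat p \<in> I" using ev(4,5) by (auto simp: I_def intro!: exI[of _ 1])
  qed (rule p)
  then obtain M where IM: "I \<subseteq> M" and "residue_field M p" by blast
  interpret residue_field M p by fact
  write cg (infix \<open>\<approx>\<close> 50)
  have cgI: "P \<approx> Q" if "ev P = ev Q" for P Q
  proof -
    have "ev (P - Q) = of_nat p * ev 0" using that by (simp add: ev)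
    then have "P - Q \<in> I" unfolding I_def by blast
    then show ?thesis using IM by (auto simp: cg_def)
  qed
  define X :: "int poly" where "X = [:0, 1:]"
  have evX: "ev X = \<zeta>" by (simp add: X_def ev)
  have XN: "X ^ N \<approx> 1" by (rule cgI) (simp add: ev evX \<zeta>N)
  have X_notin: "X ^ k \<notin> M" for k
  proof
    assume "X ^ k \<in> M"
    then have "X \<in> M" by (rule power_mem)
    then have "X ^ N \<in> M" using N mult_mem by (cases N) auto
    then show False using cg_mem[OF cg_sym[OF XN]] one_notin by blast
  qed
  have qM: "of_nat q \<in> M"
    using p_mem n mult_mem by (cases n) (auto simp: q_def)
  have Xk: "\<not> X ^ k \<approx> 1" if k: "0 < k" "k < N" for k
  proof
    assume *: "X ^ k \<approx> 1"
    have "(\<zeta> ^ k - 1) * (\<Sum>j<N. (\<zeta> ^ k) ^ j) = (\<zeta> ^ k) ^ N - 1"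
      by (rule power_diff_1_eq[symmetric])
    also have "(\<zeta> ^ k) ^ N = (\<zeta> ^ N) ^ k"
      by (metis power_mult mult.commute)
    finally have "(\<Sum>j<N. (\<zeta> ^ k) ^ j) = 0" using \<zeta>k[OF k] \<zeta>N by simp
    then have 0: "(\<Sum>j<N. (X ^ k) ^ j) \<approx> 0" by (intro cgI) (simp add: ev evX)
    have "of_nat N = (\<Sum>j<N. 1 ^ j :: int poly)" by simp
    also have "\<dots> \<approx> (\<Sum>j<N. (X ^ k) ^ j)"
      by (intro cg_sum cg_power cg_sym[OF *])
    also note 0
    finally have "of_nat N \<in> M" by (simp only: cg_0_iff)
    from diff_mem[OF qM this] show False using one_notin by (simp add: qN)
  qed
  have X_inj: "j = k" if jk: "j < N" "k < N" "X ^ j \<approx> X ^ k" for j k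
  proof -
    have "\<not> X ^ j \<approx> X ^ k" if "j < k" "k < N" for j k
    proof
      assume "X ^ j \<approx> X ^ k"
      moreover have "X ^ k - X ^ j = X ^ j * (X ^ (k - j) - 1)"
        using that by (simp add: algebra_simps power_add[symmetric])
      ultimately have "X ^ j * (X ^ (k - j) - 1) \<in> M"
        using cg_sym by (metis cg_def)
      then have "X ^ (k - j) \<approx> 1"
        using prime_mem X_notin by (auto simp: cg_def)
      then show False using Xk that by auto
    qed
    then show ?thesis using jk cg_sym by (metis nat_neq_iff)
  qed
  \<comment> \<open>Zero and the \<open>N\<close> distinct powers of \<open>X\<close>: these
    \<open>q\<close> elements turn out to represent every class exactly once.\<close>
  define S where "S = insert 0 ((\<lambda>k. X ^ k) ` {..<N})"
  have inj: "inj_on (\<lambda>k. X ^ k) {..<N}"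
    using X_inj by (intro inj_onI) auto
  have "0 \<notin> (\<lambda>k. X ^ k) ` {..<N}"
    using X_notin zero_mem by (metis imageE)
  then have cardS: "card S = q"
    by (simp add: S_def card_image[OF inj] qN)
  have finS: "finite S" by (simp add: S_def)
  have incS: "x = y" if xy: "x \<in> S" "y \<in> S" "x \<approx> y" for x y
    using xy X_inj X_notin cg_sym unfolding S_def by (auto simp: cg_0_iff dest: cg_sym)
  have X_frob: "X ^ q \<approx> X"
    using cg_mult[OF cg_refl[of X] XN] by (simp add: qN)
  have frob: "x ^ q \<approx> x" for x
  proof (induction x)
    case 0
    then show ?case using \<open>q \<ge> 2\<close> by (simp add: zero_power)
  next
    case (pCons a x)
    \<comment> \<open>The constant term and the rest are written as a two-term sum with coefficients
      1, the shape to which \<open>frobenius_sum_of_int\<close> applies.\<close>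
    have eq: "pCons a x = (\<Sum>i\<in>{0::nat, 1}. of_int 1 * (if i = 0 then of_int a else X * x))"
      by (simp add: X_def pCons_one of_int_poly)
    have "pCons a x ^ q \<approx> (\<Sum>i\<in>{0::nat, 1}. of_int 1 * (if i = 0 then of_int a else X * x) ^ q)"
      unfolding eq q_def by (rule frobenius_sum_of_int)
    also have "\<dots> = of_int a ^ q + X ^ q * x ^ q"
      by (simp add: power_mult_distrib)
    also have "\<dots> \<approx> of_int a + X * x"
    proof (intro cg_add cg_mult X_frob pCons.IH)
      show "of_int a ^ q \<approx> (of_int a :: int poly)"
        unfolding q_def
      proof (induction n)
        case (Suc k)
        have "of_int a ^ p ^ Suc k = (of_int a ^ p ^ k :: int poly) ^ p"
          by (simp add: power_mult[symmetric] mult.commute)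
        also have "\<dots> \<approx> of_int a ^ p" by (rule cg_power[OF Suc])
        also have "\<dots> \<approx> of_int a" by (rule frobenius_of_int)
        finally show ?case .
      qed simp
    qed
    also have "\<dots> = pCons a x" by (simp add: X_def of_int_poly)
    finally show ?case .
  qed
  \<comment> \<open>Every class is fixed by the \<open>q\<close>-th power map, so there are at most
    \<open>q\<close> classes, and \<open>S\<close> has already used them all.\<close>
  have covS: "\<exists>t\<in>S. x \<approx> t" for x
  proof (rule ccontr)
    assume *: "\<not> (\<exists>t\<in>S. x \<approx> t)"
    have "card (insert x S) \<le> q"
    proof (rule card_fixed_points_le)
      show "a = b" if "a \<in> insert x S" "b \<in> insert x S" "a \<approx> b" for a b
        using that * incS cg_sym by blast
    qed (use \<open>q \<ge> 2\<close> finS frob in auto)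
    moreover have "x \<notin> S" using * cg_refl by blast
    ultimately show False using finS cardS by simp
  qed
  from basis_exists[OF finS _ incS covS] cardS
  have "\<exists>w. independent {..<n} w \<and> (\<forall>x. \<exists>u. x \<approx> (\<Sum>i<n. of_int (u i) * w i))"
    by (simp add: q_def)
  then show ?thesis using \<open>residue_field M p\<close> by blast
qed

subsection \<open>Syndromes and inner rank\<close>

text \<open>While the columns of \<open>B\<close> are dependent modulo \<open>p\<close>, one column
  is a combination of the others plus a multiple of \<open>p\<close>. Substituting it alters the
  rows of \<open>C\<close> and leaves a rank-one term times \<open>p\<close>. Each discarded index
  carries just one such term, so the total number of terms does not grow.\<close>

lemma column_reduction:
  fixes B :: "nat \<Rightarrow> 'l \<Rightarrow> int" and C :: "'l \<Rightarrow> nat \<Rightarrow> int" and p m :: nat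
  assumes p: "prime p" and L: "finite L"
  shows "\<exists>K C' G D. K \<subseteq> L \<and>
    (\<forall>i<m. \<forall>k. (\<Sum>l\<in>L. B i l * C l k) =
        (\<Sum>l\<in>K. B i l * C' l k) + int p * (\<Sum>l\<in>L - K. G i l * D l k)) \<and>
    (\<forall>u. (\<forall>i<m. int p dvd (\<Sum>l\<in>K. B i l * u l)) \<longrightarrow> (\<forall>l\<in>K. int p dvd u l))"
  using L
proof (induction L arbitrary: C rule: finite_psubset_induct)
  case (psubset L)
  show ?case
  proof (cases "\<forall>u. (\<forall>i<m. int p dvd (\<Sum>l\<in>L. B i l * u l)) \<longrightarrow> (\<forall>l\<in>L. int p dvd u l)")
    case True
    then show ?thesis by (intro exI[of _ L] exI[of _ C] conjI) auto
  next
    case False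
    then obtain u l0 where u: "\<And>i. i < m \<Longrightarrow> int p dvd (\<Sum>l\<in>L. B i l * u l)"
      and l0: "l0 \<in> L" "\<not> int p dvd u l0" by blast
    have "coprime (int p) (u l0)"
      using p l0 by (intro prime_imp_coprime) auto
    then obtain x y where xy: "x * int p + y * u l0 = 1"
      using bezout_int[of "int p" "u l0"] by auto
    obtain s where s: "\<And>i. i < m \<Longrightarrow> (\<Sum>l\<in>L. B i l * u l) = int p * s i"
      using u unfolding dvd_def by metis
    define L' where "L' = L - {l0}"
    have L': "L' \<subset> L" "finite L'"
      using l0 psubset.hyps by (auto simp: L'_def)
    \<comment> \<open>Since \<open>y\<close> inverts \<open>u l0\<close> modulo \<open>p\<close>,
      column \<open>l0\<close> of \<open>B\<close> equals \<open>p * g\<close> minus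
      \<open>y\<close> times the remaining columns weighted by \<open>u\<close>. \<open>C1\<close>
      absorbs the latter part.\<close>
    define C1 where "C1 = (\<lambda>l k. C l k - y * u l * C l0 k)"
    define g where "g = (\<lambda>i. y * s i + x * B i l0)"
    from psubset.IH[OF L'(1), of C1] obtain K C' G D where K: "K \<subseteq> L'"
      and eq: "\<forall>i<m. \<forall>k. (\<Sum>l\<in>L'. B i l * C1 l k) =
        (\<Sum>l\<in>K. B i l * C' l k) + int p * (\<Sum>l\<in>L' - K. G i l * D l k)"
      and ind: "\<forall>u. (\<forall>i<m. int p dvd (\<Sum>l\<in>K. B i l * u l)) \<longrightarrow> (\<forall>l\<in>K. int p dvd u l)"
      by (elim exE conjE) (rule that)
    let ?G = "\<lambda>i l. if l = l0 then g i else G i l"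
    let ?D = "\<lambda>l k. if l = l0 then C l0 k else D l k"
    have "(\<Sum>l\<in>L. B i l * C l k) =
        (\<Sum>l\<in>K. B i l * C' l k) + int p * (\<Sum>l\<in>L - K. ?G i l * ?D l k)" if i: "i < m" for i k
    proof -
      have split: "(\<Sum>l\<in>L. F l) = F l0 + (\<Sum>l\<in>L'. F l)" for F :: "'l \<Rightarrow> int"
        using psubset.hyps l0(1) by (simp add: sum.remove L'_def)
      have "int p * s i = B i l0 * u l0 + (\<Sum>l\<in>L'. B i l * u l)"
        using s[OF i] split by metis
      moreover have "B i l0 = (x * int p + y * u l0) * B i l0" using xy by simp
      moreover have "int p * g i = y * (int p * s i) + x * int p * B i l0"
        by (simp add: g_def algebra_simps)
      ultimately have B: "B i l0 = int p * g i - y * (\<Sum>l\<in>L'. B i l * u l)"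
        by (simp add: algebra_simps)
      have "(\<Sum>l\<in>L. B i l * C l k) = B i l0 * C l0 k + (\<Sum>l\<in>L'. B i l * C l k)"
        by (rule split)
      also have "\<dots> = int p * (g i * C l0 k) + (\<Sum>l\<in>L'. B i l * C1 l k)"
        by (subst B) (simp add: C1_def algebra_simps sum_subtractf sum_distrib_left sum_distrib_right)
      also have "\<dots> = (\<Sum>l\<in>K. B i l * C' l k) +
          int p * (g i * C l0 k + (\<Sum>l\<in>L' - K. G i l * D l k))"
        using eq i by (simp add: algebra_simps)
      also have "g i * C l0 k + (\<Sum>l\<in>L' - K. G i l * D l k) = (\<Sum>l\<in>L - K. ?G i l * ?D l k)"
      proof -
        have *: "L - K = insert l0 (L' - K)" using l0(1) K by (auto simp: L'_def)
        have notin: "l0 \<notin> L'" by (simp add: L'_def)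
        have "(\<Sum>l\<in>L' - K. ?G i l * ?D l k) = (\<Sum>l\<in>L' - K. G i l * D l k)"
          using notin by (intro sum.cong) auto
        then show ?thesis unfolding * using L'(2) notin by simp
      qed
      finally show ?thesis .
    qed
    then show ?thesis
      using K L'(1) ind
      by (intro exI[of _ K] exI[of _ C'] exI[of _ ?G] exI[of _ ?D] conjI) blast+
  qed
qed

text \<open>Here \<open>t j i k k'\<close> stands for the coefficient of \<open>w\<^sub>k\<^sub>'\<close> in the expansion of
  \<open>w\<^sub>i\<^bsup>p^j\<^esup> w\<^sub>k\<close> with respect to a basis \<open>w\<close> of the field of order \<open>p\<^sup>n\<close>.\<close>

definition syndrome ::
  "nat \<Rightarrow> nat \<Rightarrow> (nat \<Rightarrow> nat \<Rightarrow> nat \<Rightarrow> nat \<Rightarrow> int) \<Rightarrow> (nat \<Rightarrow> nat \<Rightarrow> int) \<Rightarrow> nat \<Rightarrow> nat \<Rightarrow> int" where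
  "syndrome m n t A j k' = (\<Sum>i<m. \<Sum>k<n. A i k * t j i k k')"

lemma syndrome_diff: "syndrome m n t (\<lambda>i k. A i k - A' i k) j k' =
    syndrome m n t A j k' - syndrome m n t A' j k'"
  by (simp add: syndrome_def algebra_simps sum_subtractf)

lemma syndrome_scale: "syndrome m n t (\<lambda>i k. c * A i k) j k' = c * syndrome m n t A j k'"
  by (simp add: syndrome_def algebra_simps sum_distrib_left)

lemma syndrome_cong:
  "(\<And>i k. i < m \<Longrightarrow> k < n \<Longrightarrow> A i k = A' i k) \<Longrightarrow> syndrome m n t A j k' = syndrome m n t A' j k'"
  by (auto simp: syndrome_def intro!: sum.cong)

lemma syndrome_dvd_diff:
  assumes "\<And>i k. i < m \<Longrightarrow> k < n \<Longrightarrow> h dvd A i k - A' i k"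
  shows "h dvd syndrome m n t A j k' - syndrome m n t A' j k'"
  unfolding syndrome_diff[symmetric] unfolding syndrome_def
  using assms by (intro dvd_sum dvd_mult2) auto

text \<open>Over the field of order \<open>p\<close> this amounts to saying that no nonzero matrix of rank at most
  \<open>r\<close> has zero syndrome. Asking for a factorisation after division by \<open>p\<close>, with the same index set
  \<open>L\<close>, is what allows passing from \<open>p\<close> to composite moduli.\<close>

definition detects_rank ::
  "nat \<Rightarrow> nat \<Rightarrow> nat \<Rightarrow> nat \<Rightarrow> (nat \<Rightarrow> nat \<Rightarrow> nat \<Rightarrow> nat \<Rightarrow> int) \<Rightarrow> bool" where
  "detects_rank m n r p t \<longleftrightarrow> (\<forall>(L :: nat set) B C. finite L \<longrightarrow> card L \<le> r \<longrightarrow>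
     (\<forall>j<r. \<forall>k'<n. int p dvd syndrome m n t (\<lambda>i k. \<Sum>l\<in>L. B i l * C l k) j k') \<longrightarrow>
     (\<exists>B' C'. \<forall>i<m. \<forall>k<n. (\<Sum>l\<in>L. B i l * C l k) = int p * (\<Sum>l\<in>L. B' i l * C' l k)))"

lemma detects_rankE:
  fixes L :: "nat set"
  assumes "detects_rank m n r p t" "finite L" "card L \<le> r"
    and "\<And>j k'. j < r \<Longrightarrow> k' < n \<Longrightarrow>
      int p dvd syndrome m n t (\<lambda>i k. \<Sum>l\<in>L. B i l * C l k) j k'"
  obtains B' C' where "\<And>i k. i < m \<Longrightarrow> k < n \<Longrightarrow>
      (\<Sum>l\<in>L. B i l * C l k) = int p * (\<Sum>l\<in>L. B' i l * C' l k)"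
proof -
  have "\<exists>B' C'. \<forall>i<m. \<forall>k<n. (\<Sum>l\<in>L. B i l * C l k) = int p * (\<Sum>l\<in>L. B' i l * C' l k)"
    using assms(1)[unfolded detects_rank_def, rule_format, OF assms(2,3), of B C] assms(4) by blast
  then show ?thesis using that by blast
qed

lemma detects_rank_cong:
  assumes "detects_rank m n r p t" and t: "\<And>j i k k'. int p dvd t' j i k k' - t j i k k'"
  shows "detects_rank m n r p t'"
proof -
  have "int p dvd syndrome m n t' A j k' - syndrome m n t A j k'" for A j k'
    unfolding syndrome_def sum_subtractf[symmetric] right_diff_distrib[symmetric]
    by (intro dvd_sum dvd_mult t)
  then have "int p dvd syndrome m n t' A j k' \<longleftrightarrow> int p dvd syndrome m n t A j k'" for A j k'
    by (metis dvd_diff_commute dvd_diff_right_iff)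
  with assms(1) show ?thesis by (simp add: detects_rank_def)
qed

text \<open>After column reduction the kept columns of \<open>B\<close> become independent field
  elements \<open>f l\<close>. The vanishing syndromes say that the row elements \<open>c l\<close>
  solve their Moore system, so \<open>p\<close> divides all kept rows. The discarded part already
  carries a factor \<open>p\<close>.\<close>

lemma (in residue_field) gabidulin_detects_rank:
  assumes w: "independent {..<n} w" and mn: "m \<le> n"
    and t: "\<And>j i k. w i ^ (p ^ j) * w k \<approx> (\<Sum>k'<n. of_int (t j i k k') * w k')"
  shows "detects_rank m n r p t"
  unfolding detects_rank_def
proof (intro allI impI)
  fix L :: "nat set" and B C
  assume L: "finite L" "card L \<le> r" and syn: "\<forall>j<r. \<forall>k'<n.
    int p dvd syndrome m n t (\<lambda>i k. \<Sum>l\<in>L. B i l * C l k) j k'"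
  obtain K C' G D where K: "K \<subseteq> L" and
    eq: "\<forall>i<m. \<forall>k. (\<Sum>l\<in>L. B i l * C l k) =
        (\<Sum>l\<in>K. B i l * C' l k) + int p * (\<Sum>l\<in>L - K. G i l * D l k)" and
    ind: "\<forall>u. (\<forall>i<m. int p dvd (\<Sum>l\<in>K. B i l * u l)) \<longrightarrow> (\<forall>l\<in>K. int p dvd u l)"
    using column_reduction[OF prime_p L(1), of m B C] by (elim exE conjE) (rule that)
  have finK: "finite K" and cardK: "card K \<le> r"
    using K L card_mono[OF L(1) K] by (auto intro: finite_subset)
  define E where "E = (\<lambda>i k. \<Sum>l\<in>K. B i l * C' l k)"
  have synE: "int p dvd syndrome m n t E j k'" if "j < r" "k' < n" for j k'
  proof -
    let ?E = "\<lambda>i k. \<Sum>l\<in>L. B i l * C l k"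
    have "int p dvd syndrome m n t ?E j k' - syndrome m n t E j k'"
      by (rule syndrome_dvd_diff) (simp add: eq E_def)
    moreover have "int p dvd syndrome m n t ?E j k'"
      using syn that by blast
    ultimately have "int p dvd syndrome m n t ?E j k' - (syndrome m n t ?E j k' - syndrome m n t E j k')"
      using dvd_diff by blast
    then show ?thesis by simp
  qed
  \<comment> \<open>Columns of \<open>B\<close> and rows of \<open>C'\<close>, read as field
    elements through \<open>w\<close>.\<close>
  define f where "f = (\<lambda>l. \<Sum>i<m. of_int (B i l) * w i)"
  define c where "c = (\<lambda>l. \<Sum>k<n. of_int (C' l k) * w k)"
  have "independent K f"
    unfolding independent_def
  proof (intro allI impI ballI)
    fix u :: "nat \<Rightarrow> int" and l
    assume l: "l \<in> K"
    assume "(\<Sum>l\<in>K. of_int (u l) * f l) \<in> M"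
    also have "(\<Sum>l\<in>K. of_int (u l) * f l) = (\<Sum>l\<in>K. \<Sum>i<m. of_int (B i l * u l) * w i)"
      by (simp add: f_def sum_distrib_left mult_ac)
    also have "\<dots> = (\<Sum>i<m. of_int (\<Sum>l\<in>K. B i l * u l) * w i)"
      by (subst sum.swap) (simp add: sum_distrib_right)
    finally have *: "(\<Sum>i<m. of_int (\<Sum>l\<in>K. B i l * u l) * w i) \<in> M" .
    have "independent {..<m} w"
      using mn by (intro independent_subset[OF w]) auto
    from independentD[OF this *] have "int p dvd (\<Sum>l\<in>K. B i l * u l)" if "i < m" for i
      using that by blast
    then show "int p dvd u l" using ind l by blast
  qed
  moreover have "(\<Sum>l\<in>K. c l * f l ^ (p ^ j)) \<in> M" if "j < card K" for j
  proof -
    have "(\<Sum>l\<in>K. c l * f l ^ (p ^ j)) \<approx> (\<Sum>l\<in>K. c l * (\<Sum>i<m. of_int (B i l) * w i ^ (p ^ j)))"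
      unfolding f_def by (intro cg_sum cg_mult frobenius_sum_of_int) simp
    also have "\<dots> = (\<Sum>l\<in>K. \<Sum>i<m. \<Sum>k<n. of_int (B i l * C' l k) * (w i ^ (p ^ j) * w k))"
    proof (intro sum.cong refl)
      fix l
      let ?b = "\<lambda>i. of_int (B i l) * w i ^ (p ^ j)"
      have "c l * (\<Sum>i<m. ?b i) = (\<Sum>i<m. ?b i) * c l"
        by (rule mult.commute)
      also have "\<dots> = (\<Sum>i<m. \<Sum>k<n. ?b i * (of_int (C' l k) * w k))"
        unfolding c_def by (rule sum_product)
      finally show "c l * (\<Sum>i<m. ?b i) =
          (\<Sum>i<m. \<Sum>k<n. of_int (B i l * C' l k) * (w i ^ (p ^ j) * w k))"
        by (simp add: mult_ac)
    qed
    also have "\<dots> = (\<Sum>i<m. \<Sum>l\<in>K. \<Sum>k<n. of_int (B i l * C' l k) * (w i ^ (p ^ j) * w k))"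
      by (rule sum.swap)
    also have "\<dots> = (\<Sum>i<m. \<Sum>k<n. \<Sum>l\<in>K. of_int (B i l * C' l k) * (w i ^ (p ^ j) * w k))"
      by (rule sum.cong[OF refl], rule sum.swap)
    also have "\<dots> = (\<Sum>i<m. \<Sum>k<n. of_int (E i k) * (w i ^ (p ^ j) * w k))"
      by (simp add: E_def sum_distrib_right)
    also have "\<dots> \<approx> (\<Sum>i<m. \<Sum>k<n. of_int (E i k) * (\<Sum>k'<n. of_int (t j i k k') * w k'))"
      by (intro cg_sum cg_mult t) simp
    also have "\<dots> = (\<Sum>i<m. \<Sum>k<n. \<Sum>k'<n. of_int (E i k * t j i k k') * w k')"
      by (simp add: sum_distrib_left mult_ac)
    also have "\<dots> = (\<Sum>i<m. \<Sum>k'<n. \<Sum>k<n. of_int (E i k * t j i k k') * w k')"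
      by (rule sum.cong[OF refl], rule sum.swap)
    also have "\<dots> = (\<Sum>k'<n. \<Sum>i<m. \<Sum>k<n. of_int (E i k * t j i k k') * w k')"
      by (rule sum.swap)
    also have "\<dots> = (\<Sum>k'<n. of_int (syndrome m n t E j k') * w k')"
      by (simp add: syndrome_def sum_distrib_right)
    finally show ?thesis
      using that cardK synE of_int_mem_iff
      by (elim cg_mem) (auto intro!: sum_mem mult_mem)
  qed
  ultimately have "c l \<in> M" if "l \<in> K" for l
    using moore_system_trivial[OF finK] that by blast
  then have "int p dvd C' l k" if "l \<in> K" "k < n" for l k
    using independentD[OF w, of "C' l" k] that by (auto simp: c_def)
  then have C': "int p * (C' l k div int p) = C' l k" if "l \<in> K" "k < n" for l k
    using that by simp
  \<comment> \<open>Kept indices use the row divided by \<open>p\<close>, discarded ones the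
    remainder term, so the quotient is a product over the same \<open>L\<close>.\<close>
  let ?B = "\<lambda>i l. if l \<in> K then B i l else G i l"
  let ?C = "\<lambda>l k. if l \<in> K then C' l k div int p else D l k"
  have "(\<Sum>l\<in>L. B i l * C l k) = int p * (\<Sum>l\<in>L. ?B i l * ?C l k)" if "i < m" "k < n" for i k
  proof -
    have "(\<Sum>l\<in>L. ?B i l * ?C l k) = (\<Sum>l\<in>L - K. ?B i l * ?C l k) + (\<Sum>l\<in>K. ?B i l * ?C l k)"
      by (rule sum.subset_diff[OF K L(1)])
    also have "\<dots> = (\<Sum>l\<in>L - K. G i l * D l k) + (\<Sum>l\<in>K. B i l * (C' l k div int p))"
      by (intro arg_cong2[of _ _ _ _ "(+)"] sum.cong) auto
    finally have "int p * (\<Sum>l\<in>L. ?B i l * ?C l k) = int p * (\<Sum>l\<in>L - K. G i l * D l k) +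
        (\<Sum>l\<in>K. B i l * (int p * (C' l k div int p)))"
      by (simp add: algebra_simps sum_distrib_left)
    also have "(\<Sum>l\<in>K. B i l * (int p * (C' l k div int p))) = (\<Sum>l\<in>K. B i l * C' l k)"
      using that by (intro sum.cong refl) (simp only: C')
    finally show ?thesis using eq that(1) by simp
  qed
  then show "\<exists>B' C'. \<forall>i<m. \<forall>k<n. (\<Sum>l\<in>L. B i l * C l k) = int p * (\<Sum>l\<in>L. B' i l * C' l k)"
    by (intro exI[of _ ?B] exI[of _ ?C] allI impI)
qed

lemma detects_rank_prime_exists:
  assumes "prime p" "0 < n" "m \<le> n"
  shows "\<exists>t. detects_rank m n r p t"
proof -
  obtain M :: "int poly set" and w where "residue_field M p"
    and w: "residue_field.independent M p {..<n} w"
    and span: "\<forall>x. \<exists>u. residue_field.cg M x (\<Sum>i<n. of_int (u i) * w i)"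
    using residue_field_exists[OF assms(1,2)] by blast
  interpret residue_field M p by fact
  write cg (infix \<open>\<approx>\<close> 50)
  obtain u where "\<And>x. x \<approx> (\<Sum>i<n. of_int (u x i) * w i)"
    using span by metis
  then have "detects_rank m n r p (\<lambda>j i k. u (w i ^ (p ^ j) * w k))"
    by (intro gabidulin_detects_rank[OF w assms(3)])
  then show ?thesis by blast
qed

section \<open>From prime to composite moduli\<close>

lemma chinese_remainder_primes:
  fixes a :: "nat \<Rightarrow> int"
  assumes "finite P" "\<And>p. p \<in> P \<Longrightarrow> prime p"
  shows "\<exists>x. \<forall>p\<in>P. int p dvd x - a p"
proof -
  have "\<exists>x. \<forall>p\<in>P. [x = nat (a p mod int p)] (mod p)"
    using assms by (intro chinese_remainder_nat) (auto simp: primes_coprime)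
  then obtain x where x: "\<And>p. p \<in> P \<Longrightarrow> [x = nat (a p mod int p)] (mod p)" by blast
  have "int p dvd int x - a p" if "p \<in> P" for p
  proof -
    have "p > 0" using assms(2)[OF that] by (rule prime_gt_0_nat)
    then have "[int x = a p mod int p] (mod int p)"
      using x[OF that] by (simp flip: cong_int_iff)
    then show ?thesis by (simp add: cong_def mod_eq_dvd_iff)
  qed
  then show ?thesis by blast
qed

text \<open>Detection at \<open>p\<close> depends only on the coefficients modulo \<open>p\<close>,
  so each coefficient is glued separately over the distinct primes dividing \<open>h\<close>; their
  multiplicities do not enter.\<close>

lemma detects_rank_exists:
  assumes "0 < h" "0 < n" "m \<le> n"
  shows "\<exists>t. \<forall>p. prime p \<longrightarrow> p dvd h \<longrightarrow> detects_rank m n r p t"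
proof -
  define P where "P = {p. prime p \<and> p dvd h}"
  have P: "finite P" using assms(1) by (auto simp: P_def)
  have "\<forall>p\<in>P. \<exists>t. detects_rank m n r p t"
    using detects_rank_prime_exists assms by (auto simp: P_def)
  then obtain T where T: "\<And>p. p \<in> P \<Longrightarrow> detects_rank m n r p (T p)" by metis
  have "\<exists>x. \<forall>p\<in>P. int p dvd x - T p j i k k'" for j i k k'
    using P by (intro chinese_remainder_primes) (auto simp: P_def)
  then obtain t where "\<And>j i k k' p. p \<in> P \<Longrightarrow> int p dvd t j i k k' - T p j i k k'" by metis
  then have "detects_rank m n r p t" if "p \<in> P" for p
    using detects_rank_cong T that by blast
  then show ?thesis by (auto simp: P_def)
qed

lemma detects_rank_imp_dvd:
  fixes h :: nat and L :: "nat set"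
  assumes "h > 0" and "\<And>p. prime p \<Longrightarrow> p dvd h \<Longrightarrow> detects_rank m n r p t"
    and "finite L" "card L \<le> r"
    and "\<And>j k'. j < r \<Longrightarrow> k' < n \<Longrightarrow> int h dvd syndrome m n t (\<lambda>i k. \<Sum>l\<in>L. B i l * C l k) j k'"
    and "i < m" "k < n"
  shows "int h dvd (\<Sum>l\<in>L. B i l * C l k)"
  using assms
proof (induction h arbitrary: B C rule: less_induct)
  case (less h)
  show ?case
  proof (cases "h = 1")
    case False
    then obtain p where p: "prime p" "p dvd h"
      using prime_factor_nat by blast
    then obtain h' where h: "h = p * h'" by blast
    have p0: "int p \<noteq> 0" using p by auto
    have syn: "int p dvd syndrome m n t (\<lambda>i k. \<Sum>l\<in>L. B i l * C l k) j k'"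
      if "j < r" "k' < n" for j k'
      using less.prems(5)[OF that] dvd_mult_left unfolding h of_nat_mult by blast
    obtain B' C' where eq:
      "\<And>i k. i < m \<Longrightarrow> k < n \<Longrightarrow> (\<Sum>l\<in>L. B i l * C l k) = int p * (\<Sum>l\<in>L. B' i l * C' l k)"
      by (rule detects_rankE[where B = B and C = C, OF less.prems(2)[OF p] less.prems(3,4) syn that])
    \<comment> \<open>The syndrome is linear, so cancelling \<open>p\<close> leaves the same
      hypothesis for the quotient product and the smaller modulus \<open>h'\<close>.\<close>
    have "int h' dvd syndrome m n t (\<lambda>i k. \<Sum>l\<in>L. B' i l * C' l k) j k'" if "j < r" "k' < n" for j k'
    proof -
      have "int p * int h' dvd syndrome m n t (\<lambda>i k. \<Sum>l\<in>L. B i l * C l k) j k'"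
        using less.prems(5)[OF that] by (simp add: h)
      also have "syndrome m n t (\<lambda>i k. \<Sum>l\<in>L. B i l * C l k) j k' =
          syndrome m n t (\<lambda>i k. int p * (\<Sum>l\<in>L. B' i l * C' l k)) j k'"
        by (rule syndrome_cong) (rule eq)
      finally show ?thesis using p0 by (simp add: syndrome_scale)
    qed
    moreover have "h' < h" "h' > 0"
      using h less.prems(1) prime_gt_1_nat[OF p(1)] by auto
    ultimately have "int h' dvd (\<Sum>l\<in>L. B' i l * C' l k)"
      using less.prems by (intro less.IH) (auto simp: h)
    then show ?thesis using eq less.prems by (simp add: h)
  qed simp
qed

subsection \<open>Graph parameters\<close>

lemma large_fibre_exists:
  fixes V :: "'a set"
  assumes "finite V" "card V = a * b" "card (f ` V) \<le> a" "a > 0"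
  shows "\<exists>y. b \<le> card {x \<in> V. f x = y}"
proof (cases "V = {}")
  case True
  then show ?thesis using assms(2,4) by simp
next
  case False
  then obtain y where "card V \<le> card (f -` {y} \<inter> V) * card (f ` V)"
    using pigeonhole_card[of f V "f ` V"] assms(1) by auto
  also have "f -` {y} \<inter> V = {x \<in> V. f x = y}" by auto
  also have "card {x \<in> V. f x = y} * card (f ` V) \<le> card {x \<in> V. f x = y} * a"
    using assms(3) by (rule mult_le_mono2)
  finally show ?thesis
    using assms(2,4) by (auto simp: mult.commute)
qed

text \<open>An independent set meets each clique fibre of \<open>g\<close> at most once, and a
  clique meets each independent fibre of \<open>c\<close> at most once. As there are
  \<open>a * b\<close> vertices, pigeonhole makes some fibres attain both bounds. The map
  \<open>c\<close> is a proper colouring, and a largest clique shows that \<open>b\<close> colours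
  are necessary.\<close>

lemma graph_parameters:
  fixes V :: "'a set" and E :: "'a \<Rightarrow> 'a \<Rightarrow> bool"
  assumes V: "finite V" "card V = a * b" and pos: "a > 0" "b > 0"
    and g: "card (g ` V) \<le> a" and c: "card (c ` V) \<le> b"
    and clique: "\<And>x y. x \<in> V \<Longrightarrow> y \<in> V \<Longrightarrow> x \<noteq> y \<Longrightarrow> g x = g y \<Longrightarrow> E x y"
    and indep: "\<And>x y. x \<in> V \<Longrightarrow> y \<in> V \<Longrightarrow> c x = c y \<Longrightarrow> \<not> E x y"
  shows "independence_number V E = a" "clique_number V E = b" "chromatic_number V E = b"
proof -
  define is_ind where
    "is_ind S \<longleftrightarrow> S \<subseteq> V \<and> (\<forall>x\<in>S. \<forall>y\<in>S. x \<noteq> y \<longrightarrow> \<not> E x y)" for S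
  define is_clq where
    "is_clq S \<longleftrightarrow> S \<subseteq> V \<and> (\<forall>x\<in>S. \<forall>y\<in>S. x \<noteq> y \<longrightarrow> E x y)" for S
  have fin: "finite {card S | S. P S}" if "\<And>S. P S \<Longrightarrow> S \<subseteq> V" for P
    by (rule finite_subset[of _ "{..card V}"]) (use that V(1) in \<open>auto intro: card_mono\<close>)
  have ind_le: "card S \<le> a" if "is_ind S" for S
  proof -
    have "inj_on g S"
      using that clique unfolding is_ind_def inj_on_def by blast
    then have "card S = card (g ` S)" by (simp add: card_image)
    also have "\<dots> \<le> card (g ` V)"
      using that V(1) by (intro card_mono image_mono) (auto simp: is_ind_def)
    finally show ?thesis using g by simp
  qed
  \<comment> \<open>Stated for any proper colouring \<open>k\<close>: it serves both for
    \<open>c\<close> and for the competing colourings in the lower bound on the chromatic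
    number.\<close>
  have clq_le: "card S = card (k ` S)"
    if "is_clq S" "\<And>x y. x \<in> V \<Longrightarrow> y \<in> V \<Longrightarrow> E x y \<Longrightarrow> k x \<noteq> k y" for S and k :: "'a \<Rightarrow> 'd"
  proof -
    have "inj_on k S"
      using that unfolding is_clq_def inj_on_def by blast
    then show ?thesis by (simp add: card_image)
  qed
  have clq_le_b: "card S \<le> b" if "is_clq S" for S
  proof -
    have "card S = card (c ` S)"
      using indep by (intro clq_le[OF that]) auto
    also have "\<dots> \<le> card (c ` V)"
      using that V(1) by (intro card_mono image_mono) (auto simp: is_clq_def)
    finally show ?thesis using c by simp
  qed
  obtain y where y: "a \<le> card {x \<in> V. c x = y}"
    using large_fibre_exists[OF V(1) _ c, of a] V(2) pos by (auto simp: mult.commute)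
  have ind: "is_ind {x \<in> V. c x = y}"
    using indep by (auto simp: is_ind_def)
  obtain z where z: "b \<le> card {x \<in> V. g x = z}"
    using large_fibre_exists[OF V g pos(1)] by auto
  have clq: "is_clq {x \<in> V. g x = z}"
    using clique by (auto simp: is_clq_def)
  show "independence_number V E = a"
    unfolding independence_number_def is_ind_def[symmetric]
  proof (rule Max_eqI)
    show "a \<in> {card S | S. is_ind S}"
      using ind ind_le[OF ind] y by (auto intro!: exI[of _ "{x \<in> V. c x = y}"])
  qed (use ind_le in \<open>auto intro!: fin simp: is_ind_def\<close>)
  show "clique_number V E = b"
    unfolding clique_number_def is_clq_def[symmetric]
  proof (rule Max_eqI)
    show "b \<in> {card S | S. is_clq S}"
      using clq clq_le_b[OF clq] z by (auto intro!: exI[of _ "{x \<in> V. g x = z}"])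
  qed (use clq_le_b in \<open>auto intro!: fin simp: is_clq_def\<close>)
  show "chromatic_number V E = b"
    unfolding chromatic_number_def
  proof (rule Least_equality)
    have "finite (c ` V)" using V(1) by simp
    then obtain e where e: "bij_betw e (c ` V) {0..<card (c ` V)}"
      using ex_bij_betw_finite_nat by blast
    have "(e \<circ> c) ` V = {0..<card (c ` V)}"
      using e by (simp add: bij_betw_def image_comp)
    then have "(e \<circ> c) ` V \<subseteq> {..<b}"
      using c by auto
    moreover have "(e \<circ> c) x \<noteq> (e \<circ> c) y" if "x \<in> V" "y \<in> V" "E x y" for x y
      using e indep that by (auto simp: bij_betw_def dest: inj_onD)
    ultimately show "\<exists>k :: 'a \<Rightarrow> nat. k ` V \<subseteq> {..<b} \<and> (\<forall>x\<in>V. \<forall>y\<in>V. E x y \<longrightarrow> k x \<noteq> k y)"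
      by blast
  next
    fix d assume "\<exists>k :: 'a \<Rightarrow> nat. k ` V \<subseteq> {..<d} \<and> (\<forall>x\<in>V. \<forall>y\<in>V. E x y \<longrightarrow> k x \<noteq> k y)"
    then obtain k :: "'a \<Rightarrow> nat" where k: "k ` V \<subseteq> {..<d}"
      "\<And>x y. x \<in> V \<Longrightarrow> y \<in> V \<Longrightarrow> E x y \<Longrightarrow> k x \<noteq> k y" by blast
    have "b \<le> card (k ` {x \<in> V. g x = z})"
      using z clq_le[OF clq k(2)] by simp
    also have "\<dots> \<le> card {..<d}"
      using k(1) by (intro card_mono) auto
    finally show "b \<le> d" by simp
  qed
qed

section \<open>Matrices over the residue ring\<close>

lemma zmatI:
  assumes "\<And>i j. i < m \<Longrightarrow> j < n \<Longrightarrow> 0 \<le> A i j \<and> A i j < int h"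
    and "\<And>i j. \<not> (i < m \<and> j < n) \<Longrightarrow> A i j = 0"
  shows "A \<in> zmat h m n"
  unfolding zmat_def using assms by blast

lemma zmatD: "A \<in> zmat h m n \<Longrightarrow> i < m \<Longrightarrow> j < n \<Longrightarrow> 0 \<le> A i j \<and> A i j < int h"
  "A \<in> zmat h m n \<Longrightarrow> \<not> (i < m \<and> j < n) \<Longrightarrow> A i j = 0"
  unfolding zmat_def by blast+

lemma zmat_diff_mem: "h > 0 \<Longrightarrow> A \<in> zmat h m n \<Longrightarrow> B \<in> zmat h m n \<Longrightarrow> zmat_diff h A B \<in> zmat h m n"
  by (rule zmatI) (auto simp: zmat_diff_def zmatD(2))

text \<open>Extensional functions are easy to count but are undefined off the index set;
  \<open>\<phi>\<close> curries them and puts 0 there instead.\<close>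

lemma finite_card_zmat: "finite (zmat h m n) \<and> card (zmat h m n) = h ^ (n * m)"
proof -
  let ?I = "{..<m} \<times> {..<n}"
  define P where "P = ?I \<rightarrow>\<^sub>E {0..<int h}"
  define \<phi> where "\<phi> = (\<lambda>f :: nat \<times> nat \<Rightarrow> int. \<lambda>i j. if i < m \<and> j < n then f (i, j) else 0)"
  have "zmat h m n = \<phi> ` P"
  proof
    show "\<phi> ` P \<subseteq> zmat h m n"
    proof (rule image_subsetI, rule zmatI)
      fix f i j assume "f \<in> P" "i < m" "j < n"
      moreover from this have "f (i, j) \<in> {0..<int h}"
        unfolding P_def by (intro PiE_mem[of f ?I]) auto
      ultimately show "0 \<le> \<phi> f i j \<and> \<phi> f i j < int h"
        by (simp add: \<phi>_def)
    qed (auto simp: \<phi>_def)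
    show "zmat h m n \<subseteq> \<phi> ` P"
    proof
      fix A assume A: "A \<in> zmat h m n"
      have "A = \<phi> (\<lambda>(i, j)\<in>?I. A i j)"
        using zmatD(2)[OF A] by (intro ext) (auto simp: \<phi>_def)
      moreover have "(\<lambda>(i, j)\<in>?I. A i j) \<in> P"
        using zmatD(1)[OF A] by (auto simp: P_def)
      ultimately show "A \<in> \<phi> ` P" by blast
    qed
  qed
  moreover have "inj_on \<phi> P"
  proof (rule inj_onI)
    fix f f' assume f: "f \<in> P" "f' \<in> P" and eq: "\<phi> f = \<phi> f'"
    have "f (i, j) = f' (i, j)" if "i < m" "j < n" for i j
      using fun_cong[OF fun_cong[OF eq], of i j] that by (simp add: \<phi>_def)
    then show "f = f'"
      using f unfolding P_def by (intro PiE_ext) auto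
  qed
  moreover have "finite P" "card P = h ^ (n * m)"
    unfolding P_def by (rule finite_PiE, simp_all add: card_PiE card_cartesian_product mult.commute)
  ultimately show ?thesis by (simp add: card_image)
qed

text \<open>The left factor is an identity block above zeros, the right one consists of the first
  \<open>r\<close> rows. The case \<open>r = m\<close> factors every matrix.\<close>

lemma zfactors_rows:
  assumes h: "h \<ge> 2" and r: "r \<le> m" and D: "D \<in> zmat h m n"
    and rows: "\<And>i j. r \<le> i \<Longrightarrow> D i j = 0"
  shows "zfactors h m n D r"
proof -
  let ?B = "\<lambda>i l. if i = l \<and> l < r then 1 else 0 :: int"
  let ?C = "\<lambda>l j. if l < r then D l j else 0"
  have B: "?B \<in> zmat h m r" using h r by (intro zmatI) auto
  have C: "?C \<in> zmat h r n" using zmatD[OF D] r by (intro zmatI) auto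
  have "D i j = (\<Sum>l<r. ?B i l * ?C l j) mod int h" if "i < m" "j < n" for i j
  proof -
    have "(\<Sum>l<r. ?B i l * ?C l j) = (\<Sum>l<r. if l = i then D i j else 0)"
      by (intro sum.cong) auto
    also have "\<dots> = D i j"
      using rows[of i j] by (simp add: sum.delta)
    finally show ?thesis using zmatD(1)[OF D that] by simp
  qed
  then show ?thesis
    unfolding zfactors_def by (intro bexI[OF _ B] bexI[OF _ C] allI impI)
qed

theorem theorem3p4:
  fixes h m n r :: nat
  assumes "h \<ge> 2" and "1 \<le> r" and "r \<le> m" and "m \<le> n"
  shows "independence_number (zmat h m n) (bil_adj h m n r) = h ^ (n * (m - r))
       \<and> clique_number (zmat h m n) (bil_adj h m n r) = h ^ (n * r)
       \<and> chromatic_number (zmat h m n) (bil_adj h m n r) = h ^ (n * r)"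
proof -
  have h: "h > 0" and n: "n > 0" using assms by auto
  obtain t where t: "\<And>p. prime p \<Longrightarrow> p dvd h \<Longrightarrow> detects_rank m n r p t"
    using detects_rank_exists[OF h n assms(4)] by blast
  let ?V = "zmat h m n"
  \<comment> \<open>The rows from index \<open>r\<close> on, shifted to start at 0 so that the
    values are matrices with \<open>m - r\<close> rows.\<close>
  define g :: "(nat \<Rightarrow> nat \<Rightarrow> int) \<Rightarrow> nat \<Rightarrow> nat \<Rightarrow> int" where
    "g = (\<lambda>A i j. if i < m - r then A (i + r) j else 0)"
  \<comment> \<open>Reduced modulo \<open>h\<close> and padded with 0, syndromes become
    \<open>r\<close> by \<open>n\<close> matrices, which bounds the number of colours.\<close>
  define c where
    "c = (\<lambda>A j k. if j < r \<and> k < n then syndrome m n t A j k mod int h else 0)"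
  have "g ` ?V \<subseteq> zmat h (m - r) n"
  proof (rule image_subsetI, rule zmatI)
    fix A i j assume A: "A \<in> ?V"
    show "0 \<le> g A i j \<and> g A i j < int h" if "i < m - r" "j < n"
      using zmatD(1)[OF A, of "i + r" j] that by (simp add: g_def)
    show "g A i j = 0" if "\<not> (i < m - r \<and> j < n)"
      using zmatD(2)[OF A, of "i + r" j] that by (auto simp: g_def)
  qed
  then have "card (g ` ?V) \<le> card (zmat h (m - r) n)"
    by (rule card_mono[rotated]) (simp add: finite_card_zmat)
  then have card_g: "card (g ` ?V) \<le> h ^ (n * (m - r))"
    by (simp add: finite_card_zmat)
  have "c ` ?V \<subseteq> zmat h r n"
    using h by (intro image_subsetI zmatI) (auto simp: c_def)
  then have "card (c ` ?V) \<le> card (zmat h r n)"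
    by (rule card_mono[rotated]) (simp add: finite_card_zmat)
  then have card_c: "card (c ` ?V) \<le> h ^ (n * r)"
    by (simp add: finite_card_zmat)
  have "h ^ (n * m) = h ^ (n * (m - r) + n * r)"
    using assms(3) by (simp add: add_mult_distrib2[symmetric])
  then have card_V: "card ?V = h ^ (n * (m - r)) * h ^ (n * r)"
    by (simp add: finite_card_zmat power_add)
  have clique: "bil_adj h m n r A B" if AB: "A \<in> ?V" "B \<in> ?V" "A \<noteq> B" "g A = g B" for A B
  proof -
    have "zmat_diff h A B i j = 0" if "r \<le> i" for i j
    proof (cases "i < m")
      case True
      then have "i - r < m - r" "i - r + r = i"
        using \<open>r \<le> i\<close> by auto
      then have "A i j = B i j"
        using fun_cong[OF fun_cong[OF AB(4)], of "i - r" j] by (simp add: g_def)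
      then show ?thesis by (simp add: zmat_diff_def)
    qed (use AB in \<open>simp add: zmat_diff_def zmatD(2)\<close>)
    then have "zfactors h m n (zmat_diff h A B) r"
      using assms zmat_diff_mem[OF h AB(1,2)] by (intro zfactors_rows) auto
    then show ?thesis
      using AB(3) by (auto simp: bil_adj_def inner_rank_def intro: Least_le)
  qed
  have indep: "\<not> bil_adj h m n r A B" if AB: "A \<in> ?V" "B \<in> ?V" "c A = c B" for A B
  proof
    assume adj: "bil_adj h m n r A B"
    define D where "D = zmat_diff h A B"
    have D: "D \<in> ?V" unfolding D_def by (rule zmat_diff_mem[OF h AB(1,2)])
    define s where "s = inner_rank h m n D"
    \<comment> \<open>Some factorisation must exist before the least size \<open>s\<close> is known
      to be attained.\<close>
    have "zfactors h m n D m"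
      using assms(1) D by (intro zfactors_rows) (auto simp: zmatD(2))
    then have "zfactors h m n D s"
      unfolding s_def inner_rank_def by (rule LeastI)
    then obtain X Y where XY: "\<And>i k. i < m \<Longrightarrow> k < n \<Longrightarrow> D i k = (\<Sum>l<s. X i l * Y l k) mod int h"
      by (auto simp: zfactors_def)
    have s: "card {..<s} \<le> r"
      using adj by (simp add: bil_adj_def s_def D_def)
    have "int h dvd (\<Sum>l<s. X i l * Y l k)" if "i < m" "k < n" for i k
    proof (rule detects_rank_imp_dvd[OF h t _ s _ that])
      fix j k' assume jk: "j < r" "k' < n"
      let ?E = "\<lambda>i k. \<Sum>l<s. X i l * Y l k"
      \<comment> \<open>The integer product agrees with \<open>A - B\<close> entrywise modulo
        \<open>h\<close>, so equal colours of \<open>A\<close> and \<open>B\<close> force its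
        syndrome to vanish modulo \<open>h\<close>.\<close>
      have "int h dvd syndrome m n t ?E j k' - syndrome m n t (\<lambda>i k. A i k - B i k) j k'"
      proof (rule syndrome_dvd_diff)
        fix i k assume "i < m" "k < n"
        from XY[OF this] show "int h dvd ?E i k - (A i k - B i k)"
          unfolding D_def zmat_diff_def by (metis mod_eq_dvd_iff)
      qed
      moreover have "int h dvd syndrome m n t (\<lambda>i k. A i k - B i k) j k'"
        using fun_cong[OF fun_cong[OF AB(3)], of j k'] jk
        by (simp add: c_def syndrome_diff mod_eq_dvd_iff)
      ultimately have "int h dvd (syndrome m n t ?E j k' - syndrome m n t (\<lambda>i k. A i k - B i k) j k')
          + syndrome m n t (\<lambda>i k. A i k - B i k) j k'"
        by (rule dvd_add)
      then show "int h dvd syndrome m n t ?E j k'" by simp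
    qed auto
    then have "D i k = 0" if "i < m" "k < n" for i k
      using XY that by simp
    then have "A i k = B i k" if "i < m" "k < n" for i k
      using zmatD(1)[OF AB(1) that] zmatD(1)[OF AB(2) that] that
      unfolding D_def zmat_diff_def by (metis mod_0_imp_dvd mod_eq_dvd_iff mod_pos_pos_trivial)
    moreover have "A i k = B i k" if "\<not> (i < m \<and> k < n)" for i k
      using zmatD(2)[OF AB(1) that] zmatD(2)[OF AB(2) that] by simp
    ultimately have "A = B" by (intro ext) blast
    then show False using adj by (simp add: bil_adj_def)
  qed
  show ?thesis
    using graph_parameters[OF _ card_V _ _ card_g card_c clique indep] h
    by (simp add: finite_card_zmat)
qed

end
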